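(* Given any real-valued martingale $(Y_n)_{n\in\mathbb N}$ with atomless marginals (i.e. the law of each $Y_n$ is atomless), there exists a backward deterministic martingale $(X_n)_{n\in\mathbb N}$ (on some probability space) such that $X_n$ and $Y_n$ have the same law for all $n\in\mathbb N$.
   Context: A (discrete-time, real-valued) stochastic process $(X_n)_{n\in\mathbb N}$ is called backward deterministic if $(X_j)_{j=1}^n$ is $\sigma(X_n)$-measurable for all $n\in\mathbb N$. A process is a martingale here if it is a martingale with respect to its own filtration. *)

theory Defs
  imports "HOL-Probability.Probability"
begin

text \<open>
  A real-valued stochastic process is a function \<open>X :: nat \<Rightarrow> 'a \<Rightarrow> real\<close>; its initial
  variable is \<open>X 0\<close>, so that the index set \<open>{1, 2, \<dots>}\<close> is shifted by one and the segment
  \<open>X\<^sub>1, \<dots>, X\<^sub>n\<close> of the process becomes \<open>X j\<close> with \<open>j \<le> n\<close>.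
\<close>

definition natural_filtration :: "'a measure \<Rightarrow> (nat \<Rightarrow> 'a \<Rightarrow> real) \<Rightarrow> nat \<Rightarrow> 'a measure" where
  "natural_filtration M X n =
     sigma (space M) {X j -` B \<inter> space M | j B. j \<le> n \<and> B \<in> sets borel}"

definition martingale ::
    "'a measure \<Rightarrow> (nat \<Rightarrow> 'a measure) \<Rightarrow> (nat \<Rightarrow> 'a \<Rightarrow> real) \<Rightarrow> bool" where
  "martingale M F X \<longleftrightarrow>
     prob_space M \<and>
     filtration (space M) F \<and>
     (\<forall>n. subalgebra M (F n)) \<and>
     (\<forall>n. X n \<in> borel_measurable (F n)) \<and>
     (\<forall>n. integrable M (X n)) \<and>
     (\<forall>m n. m \<le> n \<longrightarrow> (AE \<omega> in M. real_cond_exp M (F m) (X n) \<omega> = X m \<omega>))"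

text \<open>
  The random vector \<open>(X j)\<close>, \<open>j \<le> n\<close>, is measurable with respect to the sigma-algebra
  generated by the single random variable \<open>X n\<close>; this is exact measurability, not
  measurability up to null sets.
\<close>

definition backward_deterministic :: "'a measure \<Rightarrow> (nat \<Rightarrow> 'a \<Rightarrow> real) \<Rightarrow> bool" where
  "backward_deterministic M X \<longleftrightarrow>
     (\<forall>n. (\<lambda>\<omega>. \<lambda>j\<in>{..n}. X j \<omega>)
        \<in> vimage_algebra (space M) (X n) borel \<rightarrow>\<^sub>M (\<Pi>\<^sub>M j\<in>{..n}. borel))"

definition atomless :: "'a measure \<Rightarrow> bool" where
  "atomless \<mu> \<longleftrightarrow>
     (\<forall>A\<in>sets \<mu>. emeasure \<mu> A > 0 \<longrightarrow>
        (\<exists>B\<in>sets \<mu>. B \<subseteq> A \<and> 0 < emeasure \<mu> B \<and> emeasure \<mu> B < emeasure \<mu> A))"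

end

theory Submission
  imports Defs
begin

text \<open>
  Let \<open>\<mu>\<close> and \<open>\<nu>\<close> be the laws of \<open>Y\<^sub>n\<close> and \<open>Y\<^sub>n\<^sub>+\<^sub>1\<close>, so that \<open>\<mu>\<close> is below \<open>\<nu>\<close> in convex order. It
  suffices to find a Borel map \<open>f\<close> that pushes \<open>\<nu>\<close> to \<open>\<mu>\<close> and satisfies \<open>E[y | f(y)] = f(y)\<close> under \<open>\<nu>\<close>:
  the Markov chain with \<open>X\<^sub>n = f\<^sub>n(X\<^sub>n\<^sub>+\<^sub>1)\<close>, obtained from Kolmogorov's extension theorem and restricted
  to the sequences satisfying these equations exactly, is then as required.

  The map \<open>f\<close> comes from a splitting property: if \<open>\<mu>\<close> restricted to \<open>I\<close> is below \<open>\<nu>\<close> restricted to \<open>C\<close> in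
  convex order and \<open>\<nu>\<close> has no atoms, then for each level \<open>t\<close> the set \<open>C\<close> splits into two pieces that
  dominate the parts of \<open>I\<close> below and above \<open>t\<close>. Splitting successively at all rational levels yields
  nested sets \<open>D\<^sub>t\<close> having the \<open>\<nu>\<close>-mass and \<open>\<nu>\<close>-moment that \<open>\<mu>\<close> gives to \<open>(-\<infinity>, t]\<close>, and
  \<open>f(y) = inf {t. y \<in> D\<^sub>t}\<close>.
\<close>

section \<open>Quantile slices of an atomless random variable\<close>

lemma set_integrable_of_integrable:
  fixes f :: "'a \<Rightarrow> real"
  assumes "integrable M f" "A \<in> sets M"
  shows "set_integrable M A f"
  using assms integrable_mult_indicator unfolding set_integrable_def by blast

lemma set_integral_Un_disjoint:
  fixes f :: "'a \<Rightarrow> real"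
  assumes "integrable M f" "A \<in> sets M" "B \<in> sets M" "A \<inter> B = {}"
  shows "(LINT x:A \<union> B|M. f x) = (LINT x:A|M. f x) + (LINT x:B|M. f x)"
  using assms by (intro set_integral_Un set_integrable_of_integrable)

lemma set_integral_Diff:
  fixes f :: "'a \<Rightarrow> real"
  assumes "integrable M f" "A \<in> sets M" "B \<in> sets M" "A \<subseteq> B"
  shows "(LINT x:B - A|M. f x) = (LINT x:B|M. f x) - (LINT x:A|M. f x)"
proof -
  have "(LINT x:A \<union> (B - A)|M. f x) = (LINT x:A|M. f x) + (LINT x:B - A|M. f x)"
    using assms by (intro set_integral_Un_disjoint) auto
  moreover have "A \<union> (B - A) = B" using assms by auto
  ultimately show ?thesis by simp
qed

lemma (in finite_measure) set_integral_affine: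
  fixes Y :: "'a \<Rightarrow> real"
  assumes "integrable M Y" "A \<in> sets M"
  shows "(LINT x:A|M. k - Y x) = k * measure M A - (LINT x:A|M. Y x)"
proof -
  have "(LINT x:A|M. k) = k * measure M A"
    using assms by (simp add: set_lebesgue_integral_def)
  moreover have "(LINT x:A|M. k - Y x) = (LINT x:A|M. k) - (LINT x:A|M. Y x)"
    using assms by (intro set_integral_diff set_integrable_of_integrable) auto
  ultimately show ?thesis by simp
qed

lemma set_integral_mono_integrable:
  fixes f g :: "'a \<Rightarrow> real"
  assumes "integrable M f" "integrable M g" "A \<in> sets M" "\<And>x. x \<in> A \<Longrightarrow> f x \<le> g x"
  shows "(LINT x:A|M. f x) \<le> (LINT x:A|M. g x)"
  using assms by (intro set_integral_mono set_integrable_of_integrable)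

lemma set_integral_null:
  fixes f :: "'a \<Rightarrow> real"
  assumes "integrable M f" "A \<in> null_sets M"
  shows "(LINT x:A|M. f x) = 0"
proof -
  have "AE x in M. indicator A x *\<^sub>R f x = 0"
    using AE_not_in[OF assms(2)] by eventually_elim auto
  then show ?thesis unfolding set_lebesgue_integral_def by (rule integral_eq_zero_AE)
qed

lemma set_integral_subset_mono:
  fixes f :: "'a \<Rightarrow> real"
  assumes "integrable M f" "A \<in> sets M" "B \<in> sets M" "A \<subseteq> B" "\<And>x. 0 \<le> f x"
  shows "(LINT x:A|M. f x) \<le> (LINT x:B|M. f x)"
proof -
  have "0 \<le> (LINT x:B - A|M. f x)"
    unfolding set_lebesgue_integral_def using assms by (intro integral_nonneg_AE) auto
  then show ?thesis using set_integral_Diff[OF assms(1-4)] by simp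
qed

section \<open>Distribution function of a variable on a set, and its lower slices\<close>

definition mass_below :: "'a measure \<Rightarrow> ('a \<Rightarrow> real) \<Rightarrow> 'a set \<Rightarrow> real \<Rightarrow> real" where
  "mass_below Q Y C a = measure Q {z \<in> C. Y z \<le> a}"

text \<open>The part of \<open>C\<close> where \<open>Y\<close> is smallest, cut at mass
  \<open>u\<close>. Comparing distribution function values rather than \<open>Y\<close> with a
  chosen quantile makes the slices nested in \<open>u\<close> and fills each flat stretch of the
  distribution function at once.\<close>

definition lower_slice :: "'a measure \<Rightarrow> ('a \<Rightarrow> real) \<Rightarrow> 'a set \<Rightarrow> real \<Rightarrow> 'a set" where
  "lower_slice Q Y C u = {y \<in> C. mass_below Q Y C (Y y) \<le> u}"

locale atomless_rv = finite_measure Q for Q :: "'b measure" +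
  fixes Y :: "'b \<Rightarrow> real"
  assumes Y_int: "integrable Q Y"
    and no_atom: "\<And>c. measure Q {y \<in> space Q. Y y = c} = 0"
begin

lemma Y_meas[measurable]: "Y \<in> borel_measurable Q"
  using Y_int by auto

lemma sublevel_sets [measurable]:
  assumes "C \<in> sets Q"
  shows "{z \<in> C. Y z \<le> a} \<in> sets Q"
proof -
  have "{z \<in> C. Y z \<le> a} = C \<inter> {z \<in> space Q. Y z \<le> a}"
    using sets.sets_into_space[OF assms] by auto
  then show ?thesis using assms by simp
qed

text \<open>All four facts come from viewing \<open>mass_below\<close> as the distribution function
  of the image under \<open>Y\<close> of \<open>Q\<close> restricted to \<open>C\<close>. Continuity
  is where the absence of point masses enters.\<close>

lemma mass_below_props:
  assumes C: "C \<in> sets Q"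
  shows mass_below_mono: "mono (mass_below Q Y C)"
    and mass_below_cont: "isCont (mass_below Q Y C) a"
    and mass_below_top: "(mass_below Q Y C \<longlongrightarrow> measure Q C) at_top"
    and mass_below_bot: "(mass_below Q Y C \<longlongrightarrow> 0) at_bot"
proof -
  have sp: "C \<subseteq> space Q" using sets.sets_into_space[OF C] .
  define R where "R = restrict_space Q C"
  have Cint: "C \<inter> space Q \<in> sets Q" using C by auto
  interpret R: finite_measure R
    unfolding R_def by (rule finite_measure_restrict_space[OF finite_measure_axioms C])
  have spR: "space R = C" unfolding R_def using sp by (auto simp: space_restrict_space)
  have YR[measurable]: "Y \<in> borel_measurable R"
    unfolding R_def by (rule measurable_restrict_space1) measurable
  define D where "D = distr R borel Y"
  interpret D0: finite_measure D unfolding D_def by (rule R.finite_measure_distr) fact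
  interpret D: finite_borel_measure D by unfold_locales (simp add: D_def)
  have meas: "measure D A = measure Q {z \<in> C. Y z \<in> A}" if "A \<in> sets borel" for A
  proof -
    have "measure D A = measure R (Y -` A \<inter> C)"
      unfolding D_def using that by (simp add: measure_distr spR)
    also have "\<dots> = measure Q (Y -` A \<inter> C)"
      unfolding R_def using Cint by (intro measure_restrict_space) auto
    also have "Y -` A \<inter> C = {z \<in> C. Y z \<in> A}" by auto
    finally show ?thesis .
  qed
  have eq: "mass_below Q Y C = cdf D"
    by (auto simp: fun_eq_iff mass_below_def cdf_def2 meas)
  have tot: "measure D (space D) = measure Q C" using meas[of UNIV] by (simp add: D_def)
  show "mono (mass_below Q Y C)" unfolding eq by (intro monoI D.cdf_nondecreasing)
  show "isCont (mass_below Q Y C) a"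
  proof -
    have "measure D {a} \<le> measure Q {z \<in> space Q. Y z = a}"
      using sp by (auto simp: meas intro!: finite_measure_mono)
    then show ?thesis unfolding eq D.isCont_cdf using no_atom[of a] measure_nonneg[of D "{a}"] by linarith
  qed
  show "(mass_below Q Y C \<longlongrightarrow> measure Q C) at_top" unfolding eq tot[symmetric] by (rule D.cdf_lim_at_top)
  show "(mass_below Q Y C \<longlongrightarrow> 0) at_bot" unfolding eq by (rule D.cdf_lim_at_bot)
qed

lemma slice_sets[measurable]:
  assumes C: "C \<in> sets Q"
  shows "lower_slice Q Y C u \<in> sets Q"
proof -
  have [measurable]: "mass_below Q Y C \<in> borel_measurable borel"
    by (rule borel_measurable_mono) (use mass_below_mono[OF C] in auto)
  have "lower_slice Q Y C u = C \<inter> {y \<in> space Q. mass_below Q Y C (Y y) \<le> u}"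
    unfolding lower_slice_def using sets.sets_into_space[OF C] by auto
  then show ?thesis using C by simp
qed

lemma slice_subset: "lower_slice Q Y C u \<subseteq> C"
  by (auto simp: lower_slice_def)

lemma slice_mono: "u \<le> v \<Longrightarrow> lower_slice Q Y C u \<subseteq> lower_slice Q Y C v"
  by (auto simp: lower_slice_def)

lemma mass_below_le: "C \<in> sets Q \<Longrightarrow> mass_below Q Y C a \<le> measure Q C"
  unfolding mass_below_def by (intro finite_measure_mono) auto

lemma slice_top:
  assumes "C \<in> sets Q" shows "lower_slice Q Y C (measure Q C) = C"
  using mass_below_le[OF assms] by (auto simp: lower_slice_def)

text \<open>By continuity of the distribution function, its sublevel set at \<open>u\<close> is a
  closed half line ending at a point where the value \<open>u\<close> is attained, and the slice is
  the part of \<open>C\<close> up to that point. Full mass is treated apart because the sublevel set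
  is then the whole line.\<close>

lemma slice_measure:
  assumes C: "C \<in> sets Q" and u: "0 \<le> u" "u \<le> measure Q C"
  shows "measure Q (lower_slice Q Y C u) = u"
proof (cases "u = measure Q C")
  case True
  then show ?thesis using slice_top[OF C] by simp
next
  case False
  then have um: "u < measure Q C" using u by simp
  let ?F = "mass_below Q Y C"
  define Z where "Z = {a. ?F a \<le> u}"
  show ?thesis
  proof (cases "Z = {}")
    case True
    have "u \<le> 0"
    proof (rule ccontr)
      assume "\<not> u \<le> 0"
      then have "eventually (\<lambda>a. ?F a < u) at_bot"
        using mass_below_bot[OF C] by (intro order_tendstoD) auto
      then obtain a where "?F a < u" unfolding eventually_at_bot_linorder by auto
      then show False using True by (auto simp: Z_def dest: less_imp_le)
    qed
    moreover have "lower_slice Q Y C u = {}" using True by (auto simp: Z_def lower_slice_def)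
    ultimately show ?thesis using u by simp
  next
    case False
    have "eventually (\<lambda>a. u < ?F a) at_top"
      using mass_below_top[OF C] um by (intro order_tendstoD) auto
    then obtain b where b: "\<And>a. b \<le> a \<Longrightarrow> u < ?F a" unfolding eventually_at_top_linorder by auto
    have bdd: "bdd_above Z"
      by (rule bdd_aboveI[of _ b]) (metis Z_def b mem_Collect_eq linorder_not_le nle_le)
    have cont: "continuous_on UNIV ?F" using mass_below_cont[OF C] by (simp add: continuous_on_eq_continuous_at)
    have "closed Z" unfolding Z_def
      by (rule closed_Collect_le[OF cont continuous_on_const])
    define s where "s = Sup Z"
    have sZ: "s \<in> Z" unfolding s_def using closed_contains_Sup[OF False bdd \<open>closed Z\<close>] .
    have Zs: "Z = {..s}"
    proof
      show "Z \<subseteq> {..s}" using cSup_upper[OF _ bdd] by (auto simp: s_def)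
      show "{..s} \<subseteq> Z" using sZ monoD[OF mass_below_mono[OF C]] by (force simp: Z_def)
    qed
    have "?F s = u"
    proof (rule ccontr)
      assume "?F s \<noteq> u"
      then have "?F s < u" using sZ by (auto simp: Z_def)
      moreover have "(?F \<longlongrightarrow> ?F s) (at_right s)"
        using mass_below_cont[OF C, of s] by (auto simp: isCont_def intro: filterlim_at_split[THEN iffD1, THEN conjunct2])
      ultimately have "eventually (\<lambda>a. ?F a < u) (at_right s)" by (intro order_tendstoD)
      moreover have "eventually (\<lambda>a. s < a) (at_right s)" by (rule eventually_at_right_less)
      ultimately have "eventually (\<lambda>a. ?F a < u \<and> s < a) (at_right s)" by eventually_elim auto
      then obtain a where "?F a < u" "s < a" using eventually_happens'[OF trivial_limit_at_right_real] by auto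
      then show False using Zs by (auto simp: Z_def set_eq_iff) (meson less_le_not_le order.strict_implies_order)
    qed
    moreover have "lower_slice Q Y C u = {y \<in> C. Y y \<le> s}"
      using Zs by (auto simp: lower_slice_def Z_def set_eq_iff)
    ultimately show ?thesis by (simp add: mass_below_def)
  qed
qed

text \<open>The supremum of \<open>Y\<close> over the slice works: it exists because any point of
  the complement bounds it from above. At this level, put payoffs vanish off the slice and are
  affine on it.\<close>

lemma slice_separated:
  assumes "C \<in> sets Q" "lower_slice Q Y C u \<noteq> {}" "C - lower_slice Q Y C u \<noteq> {}"
  obtains \<theta> where "\<And>y. y \<in> lower_slice Q Y C u \<Longrightarrow> Y y \<le> \<theta>"
    "\<And>y. y \<in> C - lower_slice Q Y C u \<Longrightarrow> \<theta> \<le> Y y"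
proof -
  let ?S = "lower_slice Q Y C u"
  have less: "Y y \<le> Y z" if "y \<in> ?S" "z \<in> C - ?S" for y z
  proof (rule ccontr)
    assume "\<not> Y y \<le> Y z"
    then have "mass_below Q Y C (Y z) \<le> mass_below Q Y C (Y y)"
      using monoD[OF mass_below_mono[OF assms(1)]] by auto
    then show False using that by (auto simp: lower_slice_def)
  qed
  obtain z where z: "z \<in> C - ?S" using assms(3) by blast
  have bdd: "bdd_above (Y ` ?S)" by (rule bdd_aboveI[of _ "Y z"]) (use less z in auto)
  show ?thesis
  proof (rule that[of "Sup (Y ` ?S)"])
    show "Y y \<le> Sup (Y ` ?S)" if "y \<in> ?S" for y using that bdd by (intro cSup_upper) auto
    show "Sup (Y ` ?S) \<le> Y y" if "y \<in> C - ?S" for y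
      using that assms(2) less by (intro cSup_least) auto
  qed
qed

text \<open>Dominated convergence applies because the indicators of the slices converge at every
  point off the level set of the distribution function at \<open>a\<close>, and that level set is
  null.\<close>

lemma slice_integral_cont:
  assumes C: "C \<in> sets Q" and h: "integrable Q h"
  shows "continuous_on {0..measure Q C} (\<lambda>u. LINT y:lower_slice Q Y C u|Q. h y :: real)"
proof (rule continuous_on_sequentiallyI)
  let ?S = "lower_slice Q Y C" and ?m = "measure Q C"
  fix v :: "nat \<Rightarrow> real" and a
  assume v: "\<forall>n. v n \<in> {0..?m}" and a: "a \<in> {0..?m}" and lim: "v \<longlonglongrightarrow> a"
  have sgl: "{y \<in> C. mass_below Q Y C (Y y) = a} \<in> null_sets Q"
  proof -
    let ?E = "{y \<in> C. mass_below Q Y C (Y y) = a}"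
    have [measurable]: "mass_below Q Y C \<in> borel_measurable borel"
      by (rule borel_measurable_mono) (use mass_below_mono[OF C] in auto)
    have "?E = C \<inter> {y \<in> space Q. mass_below Q Y C (Y y) = a}" using sets.sets_into_space[OF C] by auto
    then have E: "?E \<in> sets Q" using C by simp
    \<comment> \<open>The level set lies between the slices of masses \<open>a - e\<close> and
      \<open>a\<close>; if \<open>a - e\<close> is negative, the slice of mass \<open>a\<close> is
      already small enough.\<close>
    have "measure Q ?E \<le> e" if "e > 0" for e
    proof (cases "a - e \<ge> 0")
      case True
      have "?E \<subseteq> ?S a - ?S (a - e)" using that by (auto simp: lower_slice_def)
      then have "measure Q ?E \<le> measure Q (?S a - ?S (a - e))"
        using C by (intro finite_measure_mono) auto
      also have "\<dots> = measure Q (?S a) - measure Q (?S (a - e))"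
        using C slice_mono[of "a-e" a] that by (intro finite_measure_Diff) auto
      also have "\<dots> = e" using slice_measure[OF C, of a] slice_measure[OF C, of "a - e"] True a that by auto
      finally show ?thesis .
    next
      case False
      have "measure Q ?E \<le> measure Q (?S a)"
        using C by (intro finite_measure_mono) (auto simp: lower_slice_def)
      also have "\<dots> = a" using slice_measure[OF C, of a] a by auto
      finally show ?thesis using False by simp
    qed
    then have "measure Q ?E \<le> 0" by (rule field_le_epsilon[where y=0, simplified])
    then have "measure Q ?E = 0" using measure_nonneg[of Q ?E] by linarith
    then show ?thesis using E by (simp add: emeasure_eq_measure null_setsI)
  qed
  show "(\<lambda>n. LINT y:?S (v n)|Q. h y) \<longlonglongrightarrow> (LINT y:?S a|Q. h y)"
    unfolding set_lebesgue_integral_def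
  proof (rule integral_dominated_convergence[where w = "\<lambda>y. \<bar>h y\<bar>"])
    show "(\<lambda>x. indicat_real (?S a) x *\<^sub>R h x) \<in> borel_measurable Q" using C h by measurable
    show "(\<lambda>x. indicat_real (?S (v n)) x *\<^sub>R h x) \<in> borel_measurable Q" for n using C h by measurable
    show "integrable Q (\<lambda>y. \<bar>h y\<bar>)" using h by simp
    show "AE x in Q. norm (indicat_real (?S (v n)) x *\<^sub>R h x) \<le> \<bar>h x\<bar>" for n
      by (auto simp: indicator_def)
    show "AE x in Q. (\<lambda>n. indicat_real (?S (v n)) x *\<^sub>R h x) \<longlonglongrightarrow> indicat_real (?S a) x *\<^sub>R h x"
      using AE_not_in[OF sgl]
    proof eventually_elim
      fix y assume y: "y \<notin> {y \<in> C. mass_below Q Y C (Y y) = a}"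
      show "(\<lambda>n. indicat_real (?S (v n)) y *\<^sub>R h y) \<longlonglongrightarrow> indicat_real (?S a) y *\<^sub>R h y"
      proof (cases "y \<in> C")
        case False
        then show ?thesis by (auto simp: lower_slice_def)
      next
        case True
        then consider "mass_below Q Y C (Y y) < a" | "a < mass_below Q Y C (Y y)" using y by force
        then have "eventually (\<lambda>n. y \<in> ?S (v n) \<longleftrightarrow> y \<in> ?S a) sequentially"
        proof cases
          case 1
          have "eventually (\<lambda>n. mass_below Q Y C (Y y) < v n) sequentially" using lim 1 by (rule order_tendstoD)
          then show ?thesis by eventually_elim (use 1 True in \<open>auto simp: lower_slice_def\<close>)
        next
          case 2
          have "eventually (\<lambda>n. v n < mass_below Q Y C (Y y)) sequentially" using lim 2 by (rule order_tendstoD)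
          then show ?thesis by eventually_elim (use 2 True in \<open>auto simp: lower_slice_def\<close>)
        qed
        then have "eventually (\<lambda>n. indicat_real (?S (v n)) y *\<^sub>R h y = indicat_real (?S a) y *\<^sub>R h y) sequentially"
          by eventually_elim (auto simp: indicator_def)
        then show ?thesis by (rule tendsto_eventually)
      qed
    qed
  qed
qed

end

section \<open>Splitting a convex-order domination\<close>

text \<open>Convex order of two restricted laws, in terms of mass, mean and put potentials.\<close>

definition cx_dom ::
    "'a measure \<Rightarrow> ('a \<Rightarrow> real) \<Rightarrow> 'a set \<Rightarrow> 'b measure \<Rightarrow> ('b \<Rightarrow> real) \<Rightarrow> 'b set \<Rightarrow> bool" where
  "cx_dom P X I Q Y C \<longleftrightarrow>
     I \<in> sets P \<and> C \<in> sets Q \<and> measure P I = measure Q C \<and>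
     (LINT x:I|P. X x) = (LINT y:C|Q. Y y) \<and>
     (\<forall>k. (LINT x:I|P. max 0 (k - X x)) \<le> (LINT y:C|Q. max 0 (k - Y y)))"

locale rv_pair = P: finite_measure P + Q: finite_measure Q
  for P :: "'a measure" and Q :: "'b measure" +
  fixes X :: "'a \<Rightarrow> real" and Y :: "'b \<Rightarrow> real"
  assumes X_int: "integrable P X" and Y_int': "integrable Q Y"
begin

lemma pot_int [simp, intro]: "integrable P (\<lambda>x. max 0 (k - X x))" "integrable Q (\<lambda>x. max 0 (k - Y x))"
  using X_int Y_int' by auto

lemma aff_int [simp, intro]: "integrable P (\<lambda>x. k - X x)" "integrable Q (\<lambda>x. k - Y x)"
  using X_int Y_int' by auto

text \<open>
  The affine function of \<open>k\<close> given by the integral of \<open>k - Y\<close> over \<open>S\<close> lies below the potential of \<open>S\<close>, and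
  above the convex potential of \<open>I\<close> at the separating level \<open>\<alpha>\<close> and at \<open>t\<close>, hence also between them.
\<close>

lemma slice_dominates_potential:
  assumes I: "I \<in> sets P" and C: "C \<in> sets Q" and S: "S \<in> sets Q" "S \<subseteq> C"
    and dom: "\<And>k. (LINT x:I|P. max 0 (k - X x)) \<le> (LINT y:C|Q. max 0 (k - Y y))"
    and sep: "S \<noteq> {} \<Longrightarrow> C - S \<noteq> {} \<Longrightarrow> \<exists>\<alpha>. (\<forall>y\<in>S. Y y \<le> \<alpha>) \<and> (\<forall>y\<in>C - S. \<alpha> \<le> Y y)"
    and touch: "(LINT y:S|Q. t - Y y) = (LINT x:I|P. max 0 (t - X x))"
    and k: "k \<le> t"
  shows "(LINT x:I|P. max 0 (k - X x)) \<le> (LINT y:S|Q. max 0 (k - Y y))"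
proof -
  define \<phi> where "\<phi> k = (LINT x:I|P. max 0 (k - X x))" for k
  have Snn: "0 \<le> (LINT y:S|Q. max 0 (k - Y y))" for k
    unfolding set_lebesgue_integral_def by (intro integral_nonneg_AE) auto
  consider "S = {}" | "C - S = {}" | "S \<noteq> {}" "C - S \<noteq> {}" by blast
  then show ?thesis
  proof cases
    case 1
    \<comment> \<open>For an empty slice \<open>touch\<close> forces \<open>\<phi> t = 0\<close>,
      and potentials increase with the level.\<close>
    have "\<phi> k \<le> \<phi> t" unfolding \<phi>_def using k I by (intro set_integral_mono_integrable) auto
    also have "\<phi> t = (LINT y:{}|Q. t - Y y)" using touch 1 by (simp only: \<phi>_def)
    also have "\<dots> = 0" unfolding set_lebesgue_integral_def by simp
    finally show ?thesis using Snn[of k] by (simp add: \<phi>_def)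
  next
    case 2
    then have "S = C" using S by auto
    then show ?thesis using dom by simp
  next
    case 3
    then obtain \<alpha> where \<alpha>: "\<And>y. y \<in> S \<Longrightarrow> Y y \<le> \<alpha>" "\<And>y. y \<in> C - S \<Longrightarrow> \<alpha> \<le> Y y"
      using sep by blast
    have low: "(LINT y:C|Q. max 0 (k - Y y)) = (LINT y:S|Q. max 0 (k - Y y))" if "k \<le> \<alpha>" for k
    proof -
      have "(LINT y:C - S|Q. max 0 (k - Y y)) = (LINT y:C - S|Q. 0)"
      proof (rule set_lebesgue_integral_cong)
        show "C - S \<in> sets Q" using C S by auto
        have "max 0 (k - Y y) = 0" if "y \<in> C - S" for y
          using \<alpha>(2)[OF that] \<open>k \<le> \<alpha>\<close> by simp
        then show "\<forall>x. x \<in> C - S \<longrightarrow> max 0 (k - Y x) = 0" by blast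
      qed
      then show ?thesis using C S set_integral_Diff[of Q "\<lambda>y. max 0 (k - Y y)" S C] by simp
    qed
    show ?thesis
    proof (cases "k \<le> \<alpha>")
      case True
      then show ?thesis using dom[of k] low by simp
    next
      case False
      then have ak: "\<alpha> < k" "\<alpha> < t" using k by auto
      \<comment> \<open>The weight of \<alpha> when \<open>k\<close> is written as a convex
        combination of \<alpha> and \<open>t\<close>; \<open>pt\<close> is then convexity of the put
        payoff in its level.\<close>
      define l where "l = (t - k) / (t - \<alpha>)"
      have l: "0 \<le> l" "l \<le> 1" using ak k by (auto simp: l_def field_simps)
      have lk: "k = l * \<alpha> + (1 - l) * t"
      proof -
        have "l * (t - \<alpha>) = t - k" using ak by (simp add: l_def)
        then show ?thesis by (simp add: algebra_simps)
      qed
      have pt: "max 0 (k - x) \<le> l * max 0 (\<alpha> - x) + (1 - l) * max 0 (t - x)" for x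
      proof -
        have "l * (\<alpha> - x) \<le> l * max 0 (\<alpha> - x)" "(1-l) * (t - x) \<le> (1-l) * max 0 (t - x)"
          using l by (auto intro!: mult_left_mono)
        moreover have "0 \<le> l * max 0 (\<alpha> - x)" "0 \<le> (1-l) * max 0 (t - x)" using l by auto
        moreover have "k - x = l * (\<alpha> - x) + (1 - l) * (t - x)"
          using lk by (simp add: algebra_simps)
        ultimately show ?thesis by (auto simp: max_def)
      qed
      have "\<phi> k \<le> (LINT x:I|P. l * max 0 (\<alpha> - X x) + (1 - l) * max 0 (t - X x))"
        unfolding \<phi>_def using I by (intro set_integral_mono_integrable pt) auto
      also have "\<dots> = l * \<phi> \<alpha> + (1 - l) * \<phi> t"
        unfolding \<phi>_def using I
        by (subst set_integral_add) (auto intro!: set_integrable_of_integrable)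
      \<comment> \<open>At \<alpha> the bound comes from domination, since only \<open>S\<close>
        contributes to the potential of \<open>C\<close> there; at \<open>t\<close> it is the
        touching condition. The integral over \<open>S\<close> is affine in the level, so the two
        bounds recombine at \<open>k\<close>.\<close>
      also have "\<dots> \<le> l * (LINT y:S|Q. \<alpha> - Y y) + (1 - l) * (LINT y:S|Q. t - Y y)"
      proof -
        have "\<phi> \<alpha> \<le> (LINT y:S|Q. max 0 (\<alpha> - Y y))" unfolding \<phi>_def using dom[of \<alpha>] low[of \<alpha>] by simp
        also have "\<dots> = (LINT y:S|Q. \<alpha> - Y y)"
          using S \<alpha>(1) by (intro set_lebesgue_integral_cong) (auto simp: max_def)
        finally show ?thesis using l touch
          by (intro add_mono mult_left_mono) (auto simp: \<phi>_def)
      qed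
      also have "\<dots> = (LINT y:S|Q. k - Y y)"
        unfolding lk using S by (simp only: Q.set_integral_affine Y_int') (simp add: algebra_simps)
      also have "\<dots> \<le> (LINT y:S|Q. max 0 (k - Y y))"
        using S by (intro set_integral_mono_integrable) auto
      finally show ?thesis unfolding \<phi>_def .
    qed
  qed
qed

text \<open>Above the level \<open>t\<close> the potential of \<open>I'\<close> is affine, so equal mass and mean suffice there.\<close>

lemma cx_dom_of_slice:
  assumes dom: "cx_dom P X I Q Y C" and S: "S \<in> sets Q" "S \<subseteq> C'" "C' \<subseteq> C" "C' \<in> sets Q"
    and sep: "S \<noteq> {} \<Longrightarrow> C - S \<noteq> {} \<Longrightarrow> \<exists>\<alpha>. (\<forall>y\<in>S. Y y \<le> \<alpha>) \<and> (\<forall>y\<in>C - S. \<alpha> \<le> Y y)"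
    and I': "I' \<in> sets P" "I' \<subseteq> I" "\<And>x. x \<in> I' \<Longrightarrow> X x \<le> t" "\<And>x. x \<in> I - I' \<Longrightarrow> t \<le> X x"
    and touch: "(LINT y:S|Q. t - Y y) = (LINT x:I'|P. t - X x)"
    and mass: "measure P I' = measure Q C'"
    and mean: "(LINT x:I'|P. X x) = (LINT y:C'|Q. Y y)"
  shows "cx_dom P X I' Q Y C'"
proof -
  have I: "I \<in> sets P" and C: "C \<in> sets Q" using dom by (auto simp: cx_dom_def)
  have above: "(LINT x:I'|P. max 0 (k - X x)) = (LINT x:I'|P. k - X x)" if "t \<le> k" for k
  proof (rule set_lebesgue_integral_cong)
    have "X x \<le> k" if "x \<in> I'" for x using I'(3)[OF that] \<open>t \<le> k\<close> by simp
    then show "\<forall>x. x \<in> I' \<longrightarrow> max 0 (k - X x) = k - X x" by (auto simp: max_def)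
  qed fact
  have below: "(LINT x:I|P. max 0 (k - X x)) = (LINT x:I'|P. max 0 (k - X x))" if "k \<le> t" for k
  proof -
    have "(LINT x:I - I'|P. max 0 (k - X x)) = (LINT x:I - I'|P. 0)"
    proof (rule set_lebesgue_integral_cong)
      show "I - I' \<in> sets P" using I I' by auto
      have "max 0 (k - X x) = 0" if "x \<in> I - I'" for x using I'(4)[OF that] \<open>k \<le> t\<close> by simp
      then show "\<forall>x. x \<in> I - I' \<longrightarrow> max 0 (k - X x) = 0" by blast
    qed
    then show ?thesis using I I' set_integral_Diff[of P "\<lambda>y. max 0 (k - X y)" I' I] by simp
  qed
  have "(LINT x:I'|P. max 0 (k - X x)) \<le> (LINT y:C'|Q. max 0 (k - Y y))" for k
  proof (cases "k \<le> t")
    case True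
    \<comment> \<open>At levels up to \<open>t\<close> the points of \<open>I - I'\<close>
      contribute nothing, so the potential of \<open>I'\<close> equals that of \<open>I\<close>,
      which the slice alone already dominates.\<close>
    have "(LINT x:I|P. max 0 (k - X x)) \<le> (LINT y:S|Q. max 0 (k - Y y))"
    proof (rule slice_dominates_potential[OF I C])
      show "(LINT y:S|Q. t - Y y) = (LINT x:I|P. max 0 (t - X x))"
        using touch above[of t] below[of t] by simp
    qed (use S sep dom True in \<open>auto simp: cx_dom_def\<close>)
    also have "\<dots> \<le> (LINT y:C'|Q. max 0 (k - Y y))"
      using S by (intro set_integral_subset_mono) auto
    finally show ?thesis using below[OF True] by simp
  next
    case False
    then have "(LINT x:I'|P. max 0 (k - X x)) = (LINT y:C'|Q. k - Y y)"
      using above[of k] mass mean I' S by (simp add: P.set_integral_affine Q.set_integral_affine X_int Y_int')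
    also have "\<dots> \<le> (LINT y:C'|Q. max 0 (k - Y y))"
      using S by (intro set_integral_mono_integrable) auto
    finally show ?thesis .
  qed
  then show ?thesis using I' S mass mean by (simp add: cx_dom_def)
qed

text \<open>Call and put payoffs differ by an affine function, whose integrals agree by equality of
  mass and mean. The reflection turns upper parts into lower ones, so one slice lemma serves both
  halves of a split.\<close>

lemma cx_dom_uminus:
  assumes "cx_dom P X I Q Y C"
  shows "cx_dom P (\<lambda>x. - X x) I Q (\<lambda>y. - Y y) C"
proof -
  have I: "I \<in> sets P" and C: "C \<in> sets Q" using assms by (auto simp: cx_dom_def)
  have mx: "max 0 (k - - r) = max 0 (- k - r) - (- k - r)" for k r :: real by (auto simp: max_def)
  have "(LINT x:I|P. max 0 (k - - X x)) = (LINT x:I|P. max 0 (- k - X x)) - (LINT x:I|P. - k - X x)" for k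
    unfolding mx using I by (intro set_integral_diff set_integrable_of_integrable) auto
  moreover have "(LINT x:C|Q. max 0 (k - - Y x)) = (LINT x:C|Q. max 0 (- k - Y x)) - (LINT x:C|Q. - k - Y x)" for k
    unfolding mx using C by (intro set_integral_diff set_integrable_of_integrable) auto
  moreover have "(LINT x:I|P. - X x) = - (LINT x:I|P. X x)" "(LINT x:C|Q. - Y x) = - (LINT x:C|Q. Y x)"
    using I C X_int Y_int' by (auto intro!: set_integral_uminus set_integrable_of_integrable)
  ultimately show ?thesis
    using assms unfolding cx_dom_def
    by (simp add: P.set_integral_affine Q.set_integral_affine X_int Y_int' diff_right_mono)
qed

end

locale atomless_pair = rv_pair P Q X Y + atomless_rv Q Y
  for P :: "'a measure" and Q :: "'b measure" and X Y
begin

lemma X_meas[measurable]: "X \<in> borel_measurable P"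
  using X_int by auto

text \<open>
  In quantile coordinates of \<open>Y\<close> on \<open>C\<close>, let \<open>T u\<close> be the integral of \<open>Y - t\<close> over the lower slice of
  mass \<open>u\<close>. This is convex, and it takes the value \<open>a\<close>, the integral of \<open>X - t\<close> over
  \<open>X \<le> t\<close>, at two points \<open>c \<le> s \<le> e\<close>, where \<open>s\<close> is the mass of \<open>X \<le> t\<close>. The lower part consists of the slice
  up to \<open>c\<close> together with a window inside \<open>[c, e]\<close> of mass \<open>s - c\<close> and barycentre \<open>t\<close>.
\<close>

lemma cx_dom_split:
  assumes dom: "cx_dom P X I Q Y C"
  obtains C' where "C' \<subseteq> C" "cx_dom P X {x \<in> I. X x \<le> t} Q Y C'"
    "cx_dom P X {x \<in> I. \<not> X x \<le> t} Q Y (C - C')"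
proof -
  let ?m = "measure Q C"
  let ?S = "lower_slice Q Y C"
  have I: "I \<in> sets P" and C: "C \<in> sets Q" and m: "measure P I = ?m"
    and mean: "(LINT x:I|P. X x) = (LINT y:C|Q. Y y)"
    and pot: "\<And>k. (LINT x:I|P. max 0 (k - X x)) \<le> (LINT y:C|Q. max 0 (k - Y y))"
    using dom by (auto simp: cx_dom_def)
  define I1 where "I1 = {x \<in> I. X x \<le> t}"
  define I2 where "I2 = I - I1"
  have "I1 = I \<inter> {x \<in> space P. X x \<le> t}" using sets.sets_into_space[OF I] by (auto simp: I1_def)
  then have I1: "I1 \<in> sets P" "I1 \<subseteq> I" using I by auto
  have I2: "I2 \<in> sets P" "I2 \<subseteq> I" using I I1 by (auto simp: I2_def)
  have I2_eq: "I2 = {x \<in> I. \<not> X x \<le> t}" by (auto simp: I2_def I1_def)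
  define s where "s = measure P I1"
  have s: "0 \<le> s" "s \<le> ?m" using P.finite_measure_mono[OF I1(2) I] by (auto simp: s_def m)
  have sI2: "measure P I2 = ?m - s" unfolding I2_def s_def m[symmetric] using I I1 by (intro P.finite_measure_Diff)
  define a where "a = (LINT x:I1|P. X x) - t * s"
  have a: "a = - (LINT x:I1|P. t - X x)"
    using I1 by (simp add: a_def P.set_integral_affine X_int s_def)
  define T where "T u = (LINT y:?S u|Q. Y y) - t * u" for u
  have Teq: "(LINT y:?S u|Q. t - Y y) = - T u" if "0 \<le> u" "u \<le> ?m" for u
    using that C by (simp add: T_def Q.set_integral_affine Y_int slice_measure)
  have Tcont: "continuous_on {0..?m} T"
    unfolding T_def by (intro continuous_intros slice_integral_cont C Y_int)
  have S0: "?S 0 \<in> null_sets Q"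
    using slice_measure[OF C, of 0] slice_sets[OF C, of 0]
    by (intro null_setsI) (auto simp: Q.emeasure_eq_measure)
  have T0: "T 0 = 0" using set_integral_null[OF Y_int S0] by (simp add: T_def)
  have Tm: "T ?m = a + (LINT x:I2|P. X x - t)"
  proof -
    have "T ?m = (LINT x:I|P. X x) - t * ?m" by (simp add: T_def slice_top[OF C] mean)
    moreover have "(LINT x:I2|P. X x - t) = (LINT x:I2|P. X x) - t * measure P I2"
    proof -
      have "(LINT x:I2|P. X x - t) = (LINT x:I2|P. - (t - X x))" by simp
      also have "\<dots> = - (LINT x:I2|P. t - X x)"
        using I2 by (intro set_integral_uminus set_integrable_of_integrable) auto
      finally show ?thesis using I2 by (simp add: P.set_integral_affine X_int)
    qed
    moreover have "(LINT x:I2|P. X x) = (LINT x:I|P. X x) - (LINT x:I1|P. X x)"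
      unfolding I2_def using I I1 X_int by (intro set_integral_Diff) auto
    ultimately show ?thesis using sI2 by (simp add: a_def algebra_simps)
  qed
  have a0: "a \<le> 0" unfolding a set_lebesgue_integral_def
    by (simp, intro integral_nonneg_AE) (auto simp: I1_def indicator_def)
  have am: "a \<le> T ?m" unfolding Tm set_lebesgue_integral_def
    by (simp, intro integral_nonneg_AE) (auto simp: I2_eq indicator_def)
  have sep: "\<exists>\<theta>. (\<forall>y\<in>?S u. Y y \<le> \<theta>) \<and> (\<forall>y\<in>C - ?S u. \<theta> \<le> Y y)" if "?S u \<noteq> {}" "C - ?S u \<noteq> {}" for u
    using slice_separated[OF C that] by metis
  have slice_full: "u = ?m" if "C - ?S u = {}" "0 \<le> u" "u \<le> ?m" for u
    using that slice_measure[OF C that(2,3)] slice_subset[of C u] by (metis Diff_eq_empty_iff subset_antisym)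
  have slice_empty: "u = 0" if "?S u = {}" "0 \<le> u" "u \<le> ?m" for u
    using slice_measure[OF C that(2,3)] that by simp
  \<comment> \<open>Among parts of mass \<open>s\<close>, the lower slice has the smallest moment.
    The put comparison at its separating level \<theta> gives the inequality; empty and full slices
    have no such level and are handled directly.\<close>
  have Ts: "T s \<le> a"
  proof -
    have "(LINT y:?S s|Q. Y y) \<le> (LINT x:I1|P. X x)"
    proof (cases "?S s = {} \<or> C - ?S s = {}")
      case True
      then show ?thesis
      proof
        assume 1: "?S s = {}"
        then have "measure P I1 = 0" using slice_empty s by (simp add: s_def)
        then have "I1 \<in> null_sets P" using I1 by (auto intro!: null_setsI simp: P.emeasure_eq_measure)
        then show ?thesis using 1 set_integral_null[OF X_int] by (simp add: set_lebesgue_integral_def)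
      next
        assume 1: "C - ?S s = {}"
        then have sm: "s = ?m" using slice_full s by simp
        then have "I2 \<in> null_sets P" using I2 sI2 by (auto intro!: null_setsI simp: P.emeasure_eq_measure)
        then have "(LINT x:I2|P. X x) = 0" using set_integral_null[OF X_int] by simp
        moreover have "(LINT x:I2|P. X x) = (LINT x:I|P. X x) - (LINT x:I1|P. X x)"
          unfolding I2_def using I I1 X_int by (intro set_integral_Diff) auto
        ultimately show ?thesis using mean sm slice_top[OF C] by simp
      qed
    next
      case False
      then obtain \<theta> where \<theta>: "\<And>y. y \<in> ?S s \<Longrightarrow> Y y \<le> \<theta>" "\<And>y. y \<in> C - ?S s \<Longrightarrow> \<theta> \<le> Y y"
        using sep by blast
      have "(LINT x:I1|P. \<theta> - X x) \<le> (LINT x:I1|P. max 0 (\<theta> - X x))"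
        using I1 by (intro set_integral_mono_integrable) auto
      also have "\<dots> \<le> (LINT x:I|P. max 0 (\<theta> - X x))"
        using I1 I by (intro set_integral_subset_mono) auto
      also have "\<dots> \<le> (LINT y:C|Q. max 0 (\<theta> - Y y))" by (rule pot)
      also have "\<dots> = (LINT y:?S s|Q. \<theta> - Y y)"
        unfolding set_lebesgue_integral_def
      proof (rule Bochner_Integration.integral_cong)
        fix y
        show "indicat_real C y *\<^sub>R max 0 (\<theta> - Y y) = indicat_real (?S s) y *\<^sub>R (\<theta> - Y y)"
          using \<theta>[of y] slice_subset[of C s] by (auto simp: indicator_def max_def)
      qed simp
      finally show ?thesis using s I1 C
        by (simp add: P.set_integral_affine Q.set_integral_affine X_int Y_int s_def slice_measure)
    qed
    then show ?thesis by (simp add: T_def a_def)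
  qed
  \<comment> \<open>Since \<open>T s \<le> a\<close>, while \<open>T\<close> is at least
    \<open>a\<close> at both ends of the mass interval, the intermediate value theorem gives a
    crossing on each side of \<open>s\<close>.\<close>
  obtain c where c: "0 \<le> c" "c \<le> s" "T c = a"
    using IVT2'[of T s a 0] Ts a0 T0 s continuous_on_subset[OF Tcont, of "{0..s}"] by auto
  obtain e where e: "s \<le> e" "e \<le> ?m" "T e = a"
    using IVT'[of T s a ?m] Ts am s continuous_on_subset[OF Tcont, of "{s..?m}"] by auto
  have diffT: "T v - T u = (LINT y:?S v - ?S u|Q. Y y) - t * (v - u)" if "u \<le> v" for u v
    using C that by (simp add: T_def set_integral_Diff slice_mono Y_int algebra_simps)
  have diffm: "measure Q (?S v - ?S u) = v - u" if "0 \<le> u" "u \<le> v" "v \<le> ?m" for u v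
    using C that by (simp add: Q.finite_measure_Diff slice_mono slice_measure)
  \<comment> \<open>Convexity of \<open>T\<close> in the form needed: left of the cut at
    \<open>r\<close> the slope is at most \<open>\<theta> - t\<close>, right of it at least that.
    Depending on the sign of \<open>\<theta> - t\<close>, comparison with \<open>c\<close> or with
    \<open>e\<close> gives the bound.\<close>
  have Tr: "T r \<le> a" if r: "c \<le> r" "r \<le> e" for r
  proof (cases "?S r = {} \<or> C - ?S r = {}")
    case True
    have "0 \<le> r" "r \<le> ?m" using r c e by auto
    then have "r = 0 \<or> r = ?m" using True slice_empty slice_full by blast
    then have "r = c \<or> r = e" using r c e by auto
    then show ?thesis using c e by auto
  next
    case False
    then obtain \<theta> where \<theta>: "\<And>y. y \<in> ?S r \<Longrightarrow> Y y \<le> \<theta>" "\<And>y. y \<in> C - ?S r \<Longrightarrow> \<theta> \<le> Y y"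
      using sep by blast
    have const: "(LINT y:A|Q. \<theta>) = \<theta> * measure Q A" if "A \<in> sets Q" for A
      using that by (simp add: set_lebesgue_integral_def)
    have "(LINT y:?S r - ?S c|Q. Y y) \<le> (LINT y:?S r - ?S c|Q. \<theta>)"
      using C \<theta> Y_int by (intro set_integral_mono_integrable) auto
    then have 1: "T r - a \<le> (\<theta> - t) * (r - c)"
      using diffT[of c r] diffm[of c r] c e r C by (simp add: const algebra_simps)
    have "(LINT y:?S e - ?S r|Q. \<theta>) \<le> (LINT y:?S e - ?S r|Q. Y y)"
      using C \<theta> Y_int slice_subset[of C e] by (intro set_integral_mono_integrable) auto
    then have 2: "(\<theta> - t) * (e - r) \<le> a - T r"
      using diffT[of r e] diffm[of r e] c e r C by (simp add: const algebra_simps)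
    show ?thesis
    proof (cases "\<theta> \<le> t")
      case True
      then have "(\<theta> - t) * (r - c) \<le> 0" using r by (intro mult_nonpos_nonneg) auto
      then show ?thesis using 1 by simp
    next
      case False
      then have "0 \<le> (\<theta> - t) * (e - r)" using r by simp
      then show ?thesis using 2 by simp
    qed
  qed
  \<comment> \<open>Slide a window of mass \<open>s - c\<close> from start \<open>c\<close>, where
    the increment of \<open>T\<close> is at most zero, until it ends at \<open>e\<close>, where the
    increment is at least zero. A vanishing increment means that the integral of
    \<open>Y - t\<close> over the window is zero.\<close>
  have "\<exists>d\<ge>c. d \<le> c + e - s \<and> T (d + (s - c)) - T d = 0"
  proof (rule IVT')
    show "T (c + (s - c)) - T c \<le> 0" using Ts c by simp
    show "0 \<le> T (c + e - s + (s - c)) - T (c + e - s)" using Tr[of "c + e - s"] c e by simp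
    show "c \<le> c + e - s" using e by simp
    show "continuous_on {c..c + e - s} (\<lambda>d. T (d + (s - c)) - T d)"
      using c e s
      by (intro continuous_intros continuous_on_compose2[OF Tcont] continuous_on_subset[OF Tcont]) auto
  qed
  then obtain d where d: "c \<le> d" "d + (s - c) \<le> e" and Td: "T (d + (s - c)) = T d" by auto
  define f where "f = d + (s - c)"
  have f: "d \<le> f" "f \<le> e" "T f = T d" "f - d = s - c" using c d Td by (auto simp: f_def)
  \<comment> \<open>The slice contributes \<open>T c = a\<close> and the window contributes zero, so
    \<open>C'\<close> has the mass \<open>s\<close> and the moment of \<open>I1\<close>.\<close>
  define C' where "C' = ?S c \<union> (?S f - ?S d)"
  have sub: "?S c \<subseteq> ?S d" "?S d \<subseteq> ?S f" "?S f \<subseteq> ?S e" "?S e \<subseteq> C"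
    using d f slice_mono slice_subset by auto
  have C': "C' \<in> sets Q" "C' \<subseteq> C" using C sub by (auto simp: C'_def)
  have C'm: "measure Q C' = s"
  proof -
    have "measure Q C' = measure Q (?S c) + measure Q (?S f - ?S d)"
      unfolding C'_def using C sub by (intro Q.finite_measure_Union) auto
    then show ?thesis using diffm[of d f] slice_measure[OF C, of c] c d e f s by simp
  qed
  have C'i: "(LINT y:C'|Q. Y y) = (LINT x:I1|P. X x)"
  proof -
    have "(LINT y:C'|Q. Y y) = (LINT y:?S c|Q. Y y) + (LINT y:?S f - ?S d|Q. Y y)"
      unfolding C'_def using C sub Y_int by (intro set_integral_Un_disjoint) auto
    also have "\<dots> = (T c + t * c) + (T f - T d + t * (f - d))"
      using diffT[of d f] f by (simp add: T_def)
    also have "\<dots> = a + t * s" unfolding f(3,4) c(3) by (simp add: algebra_simps)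
    finally show ?thesis by (simp add: a_def)
  qed
  have 1: "cx_dom P X I1 Q Y C'"
  proof (rule cx_dom_of_slice[where S = "?S c" and t = t, OF dom])
    show "(LINT y:?S c|Q. t - Y y) = (LINT x:I1|P. t - X x)"
      using Teq[of c] a c s by simp
  qed (use C sub C' I1 C'm C'i sep[of c] in \<open>auto simp: C'_def I1_def s_def\<close>)
  have minus: "rv_pair P Q (\<lambda>x. - X x) (\<lambda>y. - Y y)"
    by unfold_locales (use X_int Y_int in auto)
  have C2m: "measure P I2 = measure Q (C - C')"
    using sI2 C'm C' C by (simp add: Q.finite_measure_Diff)
  have C2i: "(LINT x:I2|P. X x) = (LINT y:C - C'|Q. Y y)"
    unfolding I2_def using I I1 C C' C'i mean X_int Y_int by (simp add: set_integral_Diff)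
  \<comment> \<open>After reflection the top piece \<open>C - ?S e\<close> plays the part of the
    lower slice, with level \<open>- t\<close>. It lies in \<open>C - C'\<close> because the window
    ends no later than \<open>e\<close>, and it touches because \<open>T e = a\<close>.\<close>
  have "cx_dom P (\<lambda>x. - X x) I2 Q (\<lambda>y. - Y y) (C - C')"
  proof (rule rv_pair.cx_dom_of_slice[OF minus, where S = "C - ?S e" and t = "- t", OF cx_dom_uminus[OF dom]])
    show "C - ?S e \<noteq> {} \<Longrightarrow> C - (C - ?S e) \<noteq> {} \<Longrightarrow>
        \<exists>\<alpha>. (\<forall>y\<in>C - ?S e. - Y y \<le> \<alpha>) \<and> (\<forall>y\<in>C - (C - ?S e). \<alpha> \<le> - Y y)"
    proof -
      assume "C - ?S e \<noteq> {}" "C - (C - ?S e) \<noteq> {}"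
      moreover have "C - (C - ?S e) = ?S e" using slice_subset[of C e] by auto
      ultimately show ?thesis using sep[of e] by (metis neg_le_iff_le)
    qed
    have "(LINT y:C - ?S e|Q. - t - - Y y) = (LINT y:C - ?S e|Q. - (t - Y y))" by simp
    also have "\<dots> = - (LINT y:C - ?S e|Q. t - Y y)"
      using C by (intro set_integral_uminus set_integrable_of_integrable) auto
    also have "\<dots> = T ?m - T e"
      using C slice_subset[of C e] Teq[of e] Teq[of ?m] e s
      by (simp add: set_integral_Diff slice_top)
    also have "\<dots> = (LINT x:I2|P. X x - t)" using Tm e by simp
    finally show "(LINT y:C - ?S e|Q. - t - - Y y) = (LINT x:I2|P. - t - - X x)" by simp
    show "(LINT x:I2|P. - X x) = (LINT y:C - C'|Q. - Y y)"
      using C2i I2 C C' X_int Y_int by (simp add: set_integral_uminus set_integrable_of_integrable)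
  qed (use C C' sub I2 C2m in \<open>auto simp: C'_def I2_def I1_def\<close>)
  from rv_pair.cx_dom_uminus[OF minus this] have 2: "cx_dom P X I2 Q Y (C - C')" by simp
  show ?thesis using that[OF C'(2)] 1 2 by (simp add: I1_def I2_eq)
qed

end

section \<open>Nested cells and the backward map\<close>

context atomless_pair
begin

text \<open>
  The cells of the algebras generated by finitely many of the sets \<open>X \<le> t\<^sub>i\<close> and \<open>D\<^sub>i\<close> are paired by
  their sign pattern \<open>b\<close>.
\<close>

definition dom_cell :: "(nat \<Rightarrow> real) \<Rightarrow> (nat \<Rightarrow> 'b set) \<Rightarrow> nat set \<Rightarrow> (nat \<Rightarrow> bool) \<Rightarrow> bool" where
  "dom_cell t D J b \<longleftrightarrow>
     cx_dom P X {x \<in> space P. \<forall>i\<in>J. X x \<le> t i \<longleftrightarrow> b i} Q Y {y \<in> space Q. \<forall>i\<in>J. y \<in> D i \<longleftrightarrow> b i}"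

lemma dom_cell_cong:
  assumes "J = J'" "\<And>i. i \<in> J \<Longrightarrow> D i = D' i" "\<And>i. i \<in> J \<Longrightarrow> b i = b' i"
  shows "dom_cell t D J b = dom_cell t D' J' b'"
proof -
  have "(\<forall>i\<in>J. p i \<longleftrightarrow> b i) \<longleftrightarrow> (\<forall>i\<in>J'. p i \<longleftrightarrow> b' i)" for p
    using assms(1,3) by blast
  moreover have "(\<forall>i\<in>J'. y \<in> D i \<longleftrightarrow> b' i) \<longleftrightarrow> (\<forall>i\<in>J'. y \<in> D' i \<longleftrightarrow> b' i)" for y
    using assms(1,2) by blast
  ultimately show ?thesis unfolding dom_cell_def by simp
qed

lemma pattern_insert:
  fixes p b :: "nat \<Rightarrow> bool"
  assumes "a \<notin> J"
  shows "(\<forall>i\<in>insert a J. p i \<longleftrightarrow> (b(a := v)) i) \<longleftrightarrow> (p a \<longleftrightarrow> v) \<and> (\<forall>i\<in>J. p i \<longleftrightarrow> b i)"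
proof -
  have "(p i \<longleftrightarrow> (b(a := v)) i) = (p i \<longleftrightarrow> b i)" if "i \<in> J" for i using that assms by auto
  then show ?thesis by (simp add: ball_simps)
qed

lemma Collect_bool_split:
  shows Collect_bool_Un: "{x \<in> S. (p x \<longleftrightarrow> True) \<and> R x} \<union> {x \<in> S. (p x \<longleftrightarrow> False) \<and> R x} = {x \<in> S. R x}"
    and Collect_bool_Int: "{x \<in> S. (p x \<longleftrightarrow> True) \<and> R x} \<inter> {x \<in> S. (p x \<longleftrightarrow> False) \<and> R x} = {}"
  by auto

text \<open>The pattern on the old indices is replaced by its truncation to false from
  \<open>n\<close> on, matching the normalisation \<open>cut\<close> by which cells are
  indexed.\<close>

lemma pattern_Suc:
  fixes p b :: "nat \<Rightarrow> bool"
  shows "(\<forall>i\<in>{..<Suc n}. p i \<longleftrightarrow> b i) \<longleftrightarrow> (\<forall>i\<in>{..<n}. p i \<longleftrightarrow> i < n \<and> b i) \<and> (p n \<longleftrightarrow> b n)"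
  unfolding lessThan_Suc by (simp add: conj_commute)

text \<open>Merging two paired cells; this is how the condition at one level is forgotten.\<close>

lemma cx_dom_Un:
  assumes "cx_dom P X I Q Y C" "cx_dom P X I' Q Y C'" "I \<inter> I' = {}" "C \<inter> C' = {}"
  shows "cx_dom P X (I \<union> I') Q Y (C \<union> C')"
proof -
  have s: "I \<in> sets P" "I' \<in> sets P" "C \<in> sets Q" "C' \<in> sets Q" using assms by (auto simp: cx_dom_def)
  have P_Un: "(LINT x:I \<union> I'|P. g x) = (LINT x:I|P. g x) + (LINT x:I'|P. g x)" if "integrable P g" for g :: "'a \<Rightarrow> real"
    using that s assms(3) by (intro set_integral_Un_disjoint)
  have Q_Un: "(LINT x:C \<union> C'|Q. g x) = (LINT x:C|Q. g x) + (LINT x:C'|Q. g x)" if "integrable Q g" for g :: "'b \<Rightarrow> real"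
    using that s assms(4) by (intro set_integral_Un_disjoint)
  have "measure P (I \<union> I') = measure P I + measure P I'" "measure Q (C \<union> C') = measure Q C + measure Q C'"
    using s assms(3,4) by (auto intro!: P.finite_measure_Union Q.finite_measure_Union)
  then show ?thesis
    using assms(1,2) sets.Un[OF s(1,2)] sets.Un[OF s(3,4)] unfolding cx_dom_def
    by (simp add: P_Un Q_Un X_int Y_int add_mono)
qed

text \<open>Every cell is split at the new level and \<open>E\<close> collects the chosen lower
  parts. As different cells are disjoint, \<open>E\<close> meets each cell in precisely its own
  lower part.\<close>

lemma dom_cell_extend:
  assumes "\<And>b. dom_cell t D {..<n} b"
  shows "\<exists>E. \<forall>b. dom_cell t (D(n := E)) {..<Suc n} b"
proof -
  \<comment> \<open>Patterns that agree below \<open>n\<close> name the same cell, yet the choice of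
    \<open>C'\<close> depends on the whole pattern; truncation selects one representative for each
    cell.\<close>
  define cut :: "(nat \<Rightarrow> bool) \<Rightarrow> nat \<Rightarrow> bool" where "cut b i = (i < n \<and> b i)" for b i
  define I where "I b = {x \<in> space P. \<forall>i\<in>{..<n}. X x \<le> t i \<longleftrightarrow> b i}" for b
  define C where "C b = {y \<in> space Q. \<forall>i\<in>{..<n}. y \<in> D i \<longleftrightarrow> b i}" for b
  have "\<exists>C'. C' \<subseteq> C b \<and> cx_dom P X {x \<in> I b. X x \<le> t n} Q Y C' \<and>
      cx_dom P X {x \<in> I b. \<not> X x \<le> t n} Q Y (C b - C')" for b
  proof -
    have "cx_dom P X (I b) Q Y (C b)" using assms[of b] unfolding I_def C_def dom_cell_def .
    then show ?thesis by (rule cx_dom_split[where t = "t n"]) blast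
  qed
  then have "\<forall>b. \<exists>C'. C' \<subseteq> C b \<and> cx_dom P X {x \<in> I b. X x \<le> t n} Q Y C' \<and>
      cx_dom P X {x \<in> I b. \<not> X x \<le> t n} Q Y (C b - C')" ..
  from choice[OF this] obtain C' where C'0: "\<forall>b. C' b \<subseteq> C b \<and> cx_dom P X {x \<in> I b. X x \<le> t n} Q Y (C' b) \<and>
      cx_dom P X {x \<in> I b. \<not> X x \<le> t n} Q Y (C b - C' b)" ..
  then have C': "C' b \<subseteq> C b" "cx_dom P X {x \<in> I b. X x \<le> t n} Q Y (C' b)"
      "cx_dom P X {x \<in> I b. \<not> X x \<le> t n} Q Y (C b - C' b)" for b by blast+
  define E where "E = (\<Union>b. C' (cut b))"
  have EC: "E \<inter> C (cut b) = C' (cut b)" for b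
  proof -
    have eq: "cut b' = cut b" if "y \<in> C (cut b')" "y \<in> C (cut b)" for b' y
    proof
      fix i show "cut b' i = cut b i" using that by (cases "i < n") (simp_all add: C_def cut_def)
    qed
    show ?thesis
    proof
      show "E \<inter> C (cut b) \<subseteq> C' (cut b)"
      proof
        fix y assume y: "y \<in> E \<inter> C (cut b)"
        then obtain b' where b': "y \<in> C' (cut b')" by (auto simp: E_def)
        then show "y \<in> C' (cut b)" using eq[of y b'] C'(1)[of "cut b'"] y by auto
      qed
      show "C' (cut b) \<subseteq> E \<inter> C (cut b)" using C'(1) by (auto simp: E_def)
    qed
  qed
  have "dom_cell t (D(n := E)) {..<Suc n} b" for b
  proof -
    have Ic: "{x \<in> space P. \<forall>i\<in>{..<Suc n}. X x \<le> t i \<longleftrightarrow> b i} = {x \<in> I (cut b). X x \<le> t n \<longleftrightarrow> b n}"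
      unfolding I_def cut_def pattern_Suc by blast
    have "(\<forall>i\<in>{..<Suc n}. y \<in> (D(n := E)) i \<longleftrightarrow> b i) \<longleftrightarrow>
        (\<forall>i\<in>{..<n}. y \<in> D i \<longleftrightarrow> i < n \<and> b i) \<and> (y \<in> E \<longleftrightarrow> b n)" for y
    proof -
      have "(\<forall>i\<in>{..<n}. y \<in> (D(n := E)) i \<longleftrightarrow> i < n \<and> b i) \<longleftrightarrow> (\<forall>i\<in>{..<n}. y \<in> D i \<longleftrightarrow> i < n \<and> b i)"
        by (rule ball_cong) simp_all
      then show ?thesis unfolding pattern_Suc by (simp only: fun_upd_same)
    qed
    then have Cc: "{y \<in> space Q. \<forall>i\<in>{..<Suc n}. y \<in> (D(n := E)) i \<longleftrightarrow> b i} = {y \<in> C (cut b). y \<in> E \<longleftrightarrow> b n}"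
      unfolding C_def cut_def by blast
    show ?thesis
    proof (cases "b n")
      case True
      then have "{y \<in> C (cut b). y \<in> E \<longleftrightarrow> b n} = C' (cut b)" using EC[of b] by auto
      then show ?thesis unfolding dom_cell_def Ic Cc using C'(2)[of "cut b"] True by simp
    next
      case False
      then have "{y \<in> C (cut b). y \<in> E \<longleftrightarrow> b n} = C (cut b) - C' (cut b)" using EC[of b] by auto
      then show ?thesis unfolding dom_cell_def Ic Cc using C'(3)[of "cut b"] False by simp
    qed
  qed
  then show ?thesis by blast
qed

text \<open>Dependent choice adds one set at a time. Cells over an arbitrary finite index set then
  arise from initial segments by merging over the omitted indices.\<close>

lemma dom_cell_all:
  assumes "cx_dom P X (space P) Q Y (space Q)"
  shows "\<exists>D. \<forall>J b. finite J \<longrightarrow> dom_cell t D J b"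
proof -
  have "\<exists>DD. \<forall>n. (\<forall>b. dom_cell t (DD n) {..<n} b) \<and> (\<exists>E. DD (Suc n) = (DD n)(n := E))"
  proof (rule dependent_nat_choice)
    show "\<exists>D. \<forall>b. dom_cell t D {..<0} b" using assms by (simp add: dom_cell_def)
    show "\<exists>D'. (\<forall>b. dom_cell t D' {..<Suc n} b) \<and> (\<exists>E. D' = D(n := E))"
      if cells: "\<forall>b. dom_cell t D {..<n} b" for D n
    proof -
      obtain E where "\<forall>b. dom_cell t (D(n := E)) {..<Suc n} b"
        using dom_cell_extend[OF cells[THEN spec]] ..
      then show ?thesis by (intro exI conjI) (assumption, rule refl)
    qed
  qed
  then obtain DD where DD0: "\<forall>n. (\<forall>b. dom_cell t (DD n) {..<n} b) \<and> (\<exists>E. DD (Suc n) = (DD n)(n := E))" ..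
  have DD: "dom_cell t (DD n) {..<n} b" for n b
    by (rule spec[OF conjunct1[OF spec[OF DD0]]])
  have DS: "\<exists>E. DD (Suc n) = (DD n)(n := E)" for n
    by (rule conjunct2[OF spec[OF DD0]])
  \<comment> \<open>Stage \<open>n\<close> changes only the entry at \<open>n\<close>, so entry
    \<open>i\<close> is final from stage \<open>Suc i\<close> on and the diagonal agrees with every
    later stage.\<close>
  define D where "D i = DD (Suc i) i" for i
  have D_eq: "DD n i = D i" if "i < n" for i n
    using that
  proof (induction n)
    case (Suc n)
    show ?case
    proof (cases "i = n")
      case False
      obtain E where E: "DD (Suc n) = (DD n)(n := E)" using DS ..
      show ?thesis unfolding E using False Suc.IH Suc.prems by simp
    qed (simp add: D_def)
  qed simp
  have Dn: "dom_cell t D {..<n} b" for n b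
    by (rule iffD1[OF dom_cell_cong[OF refl _ refl] DD[of n b]]) (simp add: D_eq)
  have drop: "\<forall>b. dom_cell t D ({..<n} - F) b" if "finite F" for n F
    using that
  proof induction
    case empty
    then show ?case using Dn by simp
  next
    case (insert a F)
    show ?case
    proof (cases "a < n")
      case False
      then have eq: "{..<n} - insert a F = {..<n} - F" by auto
      show ?thesis unfolding eq by (rule insert.IH)
    next
      case True
      show ?thesis
      proof
        fix b
        let ?J = "{..<n} - insert a F"
        have J: "{..<n} - F = insert a ?J" using True insert.hyps by auto
        have aJ: "a \<notin> ?J" by simp
        let ?I = "\<lambda>v. {x \<in> space P. (X x \<le> t a \<longleftrightarrow> v) \<and> (\<forall>i\<in>?J. X x \<le> t i \<longleftrightarrow> b i)}"
        let ?C = "\<lambda>v. {y \<in> space Q. (y \<in> D a \<longleftrightarrow> v) \<and> (\<forall>i\<in>?J. y \<in> D i \<longleftrightarrow> b i)}"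
        have cells: "cx_dom P X (?I v) Q Y (?C v)" for v
        proof -
          have "dom_cell t D ({..<n} - F) (b(a := v))" using insert.IH by (rule spec)
          then have "dom_cell t D (insert a ?J) (b(a := v))" unfolding J .
          then show ?thesis unfolding dom_cell_def pattern_insert[OF aJ] .
        qed
        have "cx_dom P X (?I True \<union> ?I False) Q Y (?C True \<union> ?C False)"
          by (rule cx_dom_Un[OF cells cells Collect_bool_Int Collect_bool_Int])
        then show "dom_cell t D ?J b" unfolding dom_cell_def Collect_bool_Un .
      qed
    qed
  qed
  have "dom_cell t D J b" if fin: "finite J" for J b
  proof -
    obtain n where n: "J \<subseteq> {..<n}" using finite_nat_iff_bounded[THEN iffD1, OF fin] ..
    have "{..<n} - ({..<n} - J) = J" by (rule double_diff[OF n order_refl])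
    moreover have "finite ({..<n} - J)" by simp
    ultimately show ?thesis using spec[OF drop[of "{..<n} - J" n], of b] by (simp only:)
  qed
  then show ?thesis by (intro exI[of _ D] allI impI)
qed

text \<open>One-index cells give mass and moment. For \<open>t i \<le> t j\<close>, the cell inside
  \<open>D i\<close> and outside \<open>D j\<close> is paired with an empty event, hence is
  null.\<close>

lemma chain_exists:
  assumes "cx_dom P X (space P) Q Y (space Q)"
  shows "\<exists>D :: nat \<Rightarrow> 'b set. (\<forall>i. D i \<in> sets Q \<and>
      measure Q (D i) = measure P {x \<in> space P. X x \<le> t i} \<and>
      (LINT y:D i|Q. Y y) = (LINT x:{x \<in> space P. X x \<le> t i}|P. X x)) \<and>
    (\<forall>i j. t i \<le> t j \<longrightarrow> D i - D j \<in> null_sets Q)"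
proof -
  obtain D0 where D0: "\<And>J b. finite J \<Longrightarrow> dom_cell t D0 J b" using dom_cell_all[OF assms] by blast
  define D where "D i = {y \<in> space Q. y \<in> D0 i}" for i
  have 1: "cx_dom P X {x \<in> space P. X x \<le> t i} Q Y (D i)" for i
    using D0[of "{i}" "\<lambda>_. True"] by (simp add: dom_cell_def D_def)
  have 2: "D i - D j \<in> null_sets Q" if "t i \<le> t j" for i j
  proof (cases "i = j")
    case False
    have "cx_dom P X {x \<in> space P. X x \<le> t i \<and> \<not> X x \<le> t j} Q Y {y \<in> space Q. y \<in> D0 i \<and> y \<notin> D0 j}"
      using D0[of "{i, j}" "\<lambda>k. k = i"] False by (simp add: dom_cell_def)
    moreover have "{x \<in> space P. X x \<le> t i \<and> \<not> X x \<le> t j} = {}" using that by auto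
    moreover have "{y \<in> space Q. y \<in> D0 i \<and> y \<notin> D0 j} = D i - D j" by (auto simp: D_def)
    ultimately have "D i - D j \<in> sets Q" "measure Q (D i - D j) = 0" by (auto simp: cx_dom_def)
    then show ?thesis by (auto intro!: null_setsI simp: Q.emeasure_eq_measure)
  qed simp
  show ?thesis
    by (rule exI[of _ D]) (use 1 2 in \<open>auto simp: cx_dom_def\<close>)
qed

end

text \<open>Open half lines form an intersection-stable generator of the Borel sets;
  \<open>tot\<close> handles complements in the Dynkin induction. Constant integrands yield equality
  of laws, the integrands \<open>X\<close> and \<open>Y\<close> the barycentre identity.\<close>

lemma set_integral_eq_of_half_lines:
  fixes g X :: "'a \<Rightarrow> real" and h f :: "'b \<Rightarrow> real"
  assumes [measurable]: "X \<in> borel_measurable P" "f \<in> borel_measurable Q"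
    and g: "integrable P g" and h: "integrable Q h"
    and tot: "(LINT y|Q. h y) = (LINT x|P. g x)"
    and half: "\<And>r. (LINT y:f -` {..<r} \<inter> space Q|Q. h y) = (LINT x:X -` {..<r} \<inter> space P|P. g x)"
    and B: "B \<in> sets borel"
  shows "(LINT y:f -` B \<inter> space Q|Q. h y) = (LINT x:X -` B \<inter> space P|P. g x :: real)"
proof -
  have st: "Int_stable (range (\<lambda>r::real. {..<r}))"
    by (rule Int_stableI, clarsimp simp: greaterThan_Int_greaterThan)
  have Bs: "B \<in> sigma_sets UNIV (range (\<lambda>r::real. {..<r}))"
    using B unfolding borel_Iio by simp
  have Pow_UNIV_ge: "range (\<lambda>r::real. {..<r}) \<subseteq> Pow UNIV" by simp
  have bor: "A \<in> sets borel" if "A \<in> sigma_sets UNIV (range (\<lambda>r::real. {..<r}))" for A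
    using that unfolding borel_Iio by simp
  show ?thesis
    using st Pow_UNIV_ge Bs
  proof (induction rule: sigma_sets_induct_disjoint)
    case (basic A)
    then show ?case using half by auto
  next
    case empty
    show ?case by (simp add: set_lebesgue_integral_def)
  next
    case (compl A)
    have [measurable]: "A \<in> sets borel" using compl bor by simp
    have "f -` (UNIV - A) \<inter> space Q = space Q - (f -` A \<inter> space Q)"
      "X -` (UNIV - A) \<inter> space P = space P - (X -` A \<inter> space P)" by auto
    moreover have "f -` A \<inter> space Q \<in> sets Q" "X -` A \<inter> space P \<in> sets P" by measurable
    ultimately show ?case
      using compl by (simp add: set_integral_Diff g h set_integral_space tot)
  next
    case (union A)
    have [measurable]: "A i \<in> sets borel" for i using union bor by blast
    have Q: "(LINT y:(\<Union>i. f -` A i \<inter> space Q)|Q. h y) = (\<Sum>i. LINT y:f -` A i \<inter> space Q|Q. h y)"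
      using union h
      by (intro lebesgue_integral_countable_add set_integrable_of_integrable)
        (auto simp: disjoint_family_on_def)
    have P: "(LINT y:(\<Union>i. X -` A i \<inter> space P)|P. g y) = (\<Sum>i. LINT y:X -` A i \<inter> space P|P. g y)"
      using union g
      by (intro lebesgue_integral_countable_add set_integrable_of_integrable)
        (auto simp: disjoint_family_on_def)
    have "f -` (\<Union>i. A i) \<inter> space Q = (\<Union>i. f -` A i \<inter> space Q)"
      "X -` (\<Union>i. A i) \<inter> space P = (\<Union>i. X -` A i \<inter> space P)" by auto
    then show ?case using Q P union by simp
  qed
qed

section \<open>From the chain of sets to the backward map\<close>

locale atomless_prob_pair = atomless_pair P Q X Y + P: prob_space P + Q: prob_space Q
  for P :: "'a measure" and Q :: "'b measure" and X Y
begin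

text \<open>Almost everywhere, \<open>f y < r\<close> means that \<open>y\<close> lies in some
  \<open>D i\<close> with \<open>t i < r\<close>. Letting rational levels tend to \<open>r\<close>
  from below carries masses and moments from the chain to open half lines, hence to all Borel
  sets.\<close>

lemma backward_map_exists:
  assumes dom: "cx_dom P X (space P) Q Y (space Q)"
  shows "\<exists>f \<in> borel_measurable Q. distr Q borel f = distr P borel X \<and>
    (\<forall>B\<in>sets borel. (LINT y:f -` B \<inter> space Q|Q. Y y) = (LINT x:X -` B \<inter> space P|P. X x))"
proof -
  define t where "t = from_nat_into (\<rat> :: real set)"
  have "(\<rat> :: real set) \<noteq> {}" by auto
  then have rt: "range t = \<rat>" unfolding t_def using countable_rat by (rule range_from_nat_into)
  obtain D where Ds[measurable]: "\<And>i. D i \<in> sets Q"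
    and Dm: "\<And>i. measure Q (D i) = measure P {x \<in> space P. X x \<le> t i}"
    and Di: "\<And>i. (LINT y:D i|Q. Y y) = (LINT x:{x \<in> space P. X x \<le> t i}|P. X x)"
    and Dn: "\<And>i j. t i \<le> t j \<Longrightarrow> D i - D j \<in> null_sets Q"
    using chain_exists[OF dom, of t] by metis
  \<comment> \<open>The failures of monotonicity of the chain, a countable union of null
    sets.\<close>
  define Z where "Z = (\<Union>i j. if t i \<le> t j then D i - D j else {})"
  have Z: "Z \<in> null_sets Q" unfolding Z_def using Dn by (intro null_sets_UN) auto
  \<comment> \<open>Points in no \<open>D i\<close> or in all of them are removed as well: there the
    infimum would be over the empty set or over a set unbounded below.\<close>
  define G where "G = (\<Union>i. D i) - (\<Inter>i. D i) - Z"
  have Zm[measurable]: "Z \<in> sets Q" using Z by auto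
  have Gm[measurable]: "G \<in> sets Q" unfolding G_def by measurable
  have Gsp: "G \<subseteq> space Q" using sets.sets_into_space[OF Gm] .
  have up: "measure Q (\<Union>i. D i) = 1"
  proof -
    interpret D: real_distribution "distr P borel X" by (rule P.real_distribution_distr) simp
    have "cdf (distr P borel X) (real k) \<le> measure Q (\<Union>i. D i)" for k
    proof -
      have "real k \<in> range t" unfolding rt by simp
      then obtain i where "t i = real k" by (metis imageE)
      then have "cdf (distr P borel X) (real k) = measure Q (D i)"
        using Dm[of i] by (auto simp: cdf_def2 measure_distr intro!: arg_cong[where f="measure P"])
      also have "\<dots> \<le> measure Q (\<Union>i. D i)" by (intro Q.finite_measure_mono) auto
      finally show ?thesis .
    qed
    then have "1 \<le> measure Q (\<Union>i. D i)"
      using LIMSEQ_le_const2[OF D.cdf_lim_infty_prob] by blast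
    then show ?thesis using Q.prob_le_1[of "\<Union>i. D i"] by linarith
  qed
  have down: "measure Q (\<Inter>i. D i) = 0"
  proof -
    interpret D: real_distribution "distr P borel X" by (rule P.real_distribution_distr) simp
    have "measure Q (\<Inter>i. D i) \<le> cdf (distr P borel X) (- real k)" for k
    proof -
      have "- real k \<in> range t" unfolding rt by simp
      then obtain i where "t i = - real k" by (metis imageE)
      then have "cdf (distr P borel X) (- real k) = measure Q (D i)"
        using Dm[of i] by (auto simp: cdf_def2 measure_distr intro!: arg_cong[where f="measure P"])
      also have "\<dots> \<ge> measure Q (\<Inter>i. D i)" by (intro Q.finite_measure_mono) auto
      finally show ?thesis .
    qed
    then have "measure Q (\<Inter>i. D i) \<le> 0"
      using LIMSEQ_le_const[OF D.cdf_lim_neg_infty] by blast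
    then show ?thesis using measure_nonneg[of Q "\<Inter>i. D i"] by linarith
  qed
  have aeG: "AE y in Q. y \<in> G"
  proof -
    have "AE y in Q. y \<in> (\<Union>i. D i)" using up by (intro Q.AE_prob_1)
    moreover have "AE y in Q. y \<notin> (\<Inter>i. D i)"
      using down by (intro AE_not_in null_setsI) (auto simp: Q.emeasure_eq_measure)
    moreover have "AE y in Q. y \<notin> Z" using Z by (rule AE_not_in)
    ultimately show ?thesis by eventually_elim (auto simp: G_def)
  qed
  define f where "f y = (if y \<in> G then Inf {t i | i. y \<in> D i} else 0)" for y
  have mono: "y \<in> D j" if "y \<in> G" "y \<in> D i" "t i \<le> t j" for y i j
    using that by (auto simp: G_def Z_def split: if_splits)
  have f_less: "f y < r \<longleftrightarrow> (\<exists>i. t i < r \<and> y \<in> D i)" if y: "y \<in> G" for y r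
  proof -
    have ne: "{t i | i. y \<in> D i} \<noteq> {}" using y by (auto simp: G_def)
    \<comment> \<open>On \<open>G\<close> membership passes to higher levels, so any level whose set
      misses \<open>y\<close> is a lower bound.\<close>
    obtain j where "y \<notin> D j" using y by (auto simp: G_def)
    then have "bdd_below {t i | i. y \<in> D i}"
      using mono[OF y, of _ j] by (intro bdd_belowI[of _ "t j"]) (smt (verit) mem_Collect_eq)
    then show ?thesis using cInf_less_iff[OF ne] y by (auto simp: f_def)
  qed
  have f_meas[measurable]: "f \<in> borel_measurable Q"
    unfolding borel_measurable_iff_less
  proof
    fix r
    \<comment> \<open>The second piece accounts for the default value 0 off \<open>G\<close>: it is
      \<open>space Q - G\<close> when \<open>r\<close> is positive and empty otherwise.\<close>
    have "{y \<in> space Q. f y < r} = (G \<inter> (\<Union>i\<in>{i. t i < r}. D i)) \<union> ((space Q - G) \<inter> {y \<in> space Q. 0 < r})"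
      using f_less Gsp by (auto simp: f_def)
    then show "{y \<in> space Q. f y < r} \<in> sets Q" by simp
  qed
  have half: "(LINT y:f -` {..<r} \<inter> space Q|Q. h y) = (LINT x:X -` {..<r} \<inter> space P|P. g x)"
    if h: "integrable Q h" and g: "integrable P g"
      and eq: "\<And>i. (LINT y:D i|Q. h y) = (LINT x:{x \<in> space P. X x \<le> t i}|P. g x)"
    for h :: "'b \<Rightarrow> real" and g :: "'a \<Rightarrow> real" and r
  proof -
    \<comment> \<open>Levels strictly below \<open>r\<close> are needed so that the limit is the
      open half line, even if the law of \<open>X\<close> has an atom at \<open>r\<close>.\<close>
    have "\<exists>i. r - 1 / real (Suc k) < t i \<and> t i < r" for k
    proof -
      obtain q where "q \<in> \<rat>" "r - 1 / real (Suc k) < q" "q < r"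
        using Rats_dense_in_real[of "r - 1 / real (Suc k)" r] by auto
      then show ?thesis using rt by (metis imageE)
    qed
    then obtain i where i: "\<And>k. r - 1 / real (Suc k) < t (i k)" "\<And>k. t (i k) < r" by metis
    have lim: "(\<lambda>k. t (i k)) \<longlonglongrightarrow> r"
    proof (rule tendsto_sandwich[of "\<lambda>k. r - 1 / real (Suc k)" _ _ "\<lambda>_. r"])
      show "(\<lambda>k. r - 1 / real (Suc k)) \<longlonglongrightarrow> r"
        using tendsto_diff[OF tendsto_const[of r] lim_1_over_n[THEN LIMSEQ_Suc]] by simp
    qed (use i in \<open>auto intro!: always_eventually less_imp_le\<close>)
    have evl: "eventually (\<lambda>k. z \<le> t (i k)) sequentially" if "z < r" for z
      using order_tendstoD(1)[OF lim that] by eventually_elim simp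
    have 1: "(\<lambda>k. LINT y:D (i k)|Q. h y) \<longlonglongrightarrow> (LINT y:f -` {..<r} \<inter> space Q|Q. h y)"
      unfolding set_lebesgue_integral_def
    proof (rule integral_dominated_convergence[where w = "\<lambda>y. \<bar>h y\<bar>"])
      show "AE y in Q. (\<lambda>k. indicat_real (D (i k)) y *\<^sub>R h y) \<longlonglongrightarrow>
          indicat_real (f -` {..<r} \<inter> space Q) y *\<^sub>R h y"
        using aeG
      proof eventually_elim
        fix y assume y: "y \<in> G"
        have "eventually (\<lambda>k. y \<in> D (i k) \<longleftrightarrow> f y < r) sequentially"
        proof (cases "f y < r")
          case True
          then obtain j where "t j < r" "y \<in> D j" using f_less[OF y] by blast
          then show ?thesis using evl[OF \<open>t j < r\<close>]
            by (auto elim!: eventually_mono intro: mono[OF y] simp: True)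
        next
          case False
          then have "y \<notin> D (i k)" for k using f_less[OF y] i(2) by blast
          then show ?thesis using False by simp
        qed
        then have "eventually (\<lambda>k. indicat_real (D (i k)) y *\<^sub>R h y =
            indicat_real (f -` {..<r} \<inter> space Q) y *\<^sub>R h y) sequentially"
          by eventually_elim (use y Gsp in \<open>auto simp: indicator_def\<close>)
        then show "(\<lambda>k. indicat_real (D (i k)) y *\<^sub>R h y) \<longlonglongrightarrow>
          indicat_real (f -` {..<r} \<inter> space Q) y *\<^sub>R h y" by (rule tendsto_eventually)
      qed
    qed (use h in \<open>auto simp: indicator_def\<close>)
    have 2: "(\<lambda>k. LINT x:{x \<in> space P. X x \<le> t (i k)}|P. g x) \<longlonglongrightarrow> (LINT x:X -` {..<r} \<inter> space P|P. g x)"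
      unfolding set_lebesgue_integral_def
    proof (rule integral_dominated_convergence[where w = "\<lambda>y. \<bar>g y\<bar>"])
      have "(\<lambda>k. indicat_real {x \<in> space P. X x \<le> t (i k)} x *\<^sub>R g x) \<longlonglongrightarrow>
          indicat_real (X -` {..<r} \<inter> space P) x *\<^sub>R g x" for x
      proof (rule tendsto_eventually)
        have "eventually (\<lambda>k. X x \<le> t (i k) \<longleftrightarrow> X x < r) sequentially"
        proof (cases "X x < r")
          case True
          then show ?thesis using evl[OF True] by simp
        next
          case False
          then have "\<not> X x \<le> t (i k)" for k using i(2)[of k] by auto
          then show ?thesis using False by simp
        qed
        then show "eventually (\<lambda>k. indicat_real {x \<in> space P. X x \<le> t (i k)} x *\<^sub>R g x =
          indicat_real (X -` {..<r} \<inter> space P) x *\<^sub>R g x) sequentially"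
          by eventually_elim (auto simp: indicator_def)
      qed
      then show "AE x in P. (\<lambda>k. indicat_real {x \<in> space P. X x \<le> t (i k)} x *\<^sub>R g x) \<longlonglongrightarrow>
          indicat_real (X -` {..<r} \<inter> space P) x *\<^sub>R g x" by simp
    qed (use g in \<open>auto simp: indicator_def\<close>)
    show ?thesis using LIMSEQ_unique[OF 1] 2 eq by simp
  qed
  have X0: "{x \<in> space P. X x \<le> t i} \<in> sets P" for i by measurable
  have law: "measure Q (f -` B \<inter> space Q) = measure P (X -` B \<inter> space P)" if B: "B \<in> sets borel" for B
  proof -
    have "(LINT y:f -` B \<inter> space Q|Q. 1) = (LINT x:X -` B \<inter> space P|P. 1 :: real)"
    proof (rule set_integral_eq_of_half_lines[OF X_meas f_meas _ _ _ _ B])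
      show "(LINT y:f -` {..<r} \<inter> space Q|Q. 1) = (LINT x:X -` {..<r} \<inter> space P|P. 1 :: real)" for r
        by (rule half) (auto simp: set_lebesgue_integral_def sets.Int_space_eq2 Dm X0)
    qed (auto simp: P.prob_space Q.prob_space)
    then show ?thesis using B by (simp add: set_lebesgue_integral_def sets.Int_space_eq2)
  qed
  have bary: "(LINT y:f -` B \<inter> space Q|Q. Y y) = (LINT x:X -` B \<inter> space P|P. X x)" if B: "B \<in> sets borel" for B
  proof (rule set_integral_eq_of_half_lines[OF X_meas f_meas X_int Y_int _ _ B])
    show "(LINT y|Q. Y y) = (LINT x|P. X x)"
      using dom X_int Y_int by (simp add: cx_dom_def set_integral_space)
    show "(LINT y:f -` {..<r} \<inter> space Q|Q. Y y) = (LINT x:X -` {..<r} \<inter> space P|P. X x)" for r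
      by (rule half[OF Y_int X_int Di])
  qed
  have "distr Q borel f = distr P borel X"
  proof (rule measure_eqI)
    fix B assume "B \<in> sets (distr Q borel f)"
    then have B: "B \<in> sets borel" by simp
    then show "emeasure (distr Q borel f) B = emeasure (distr P borel X) B"
      using law[OF B] by (simp add: emeasure_distr P.emeasure_eq_measure Q.emeasure_eq_measure)
  qed simp
  then show ?thesis using f_meas bary by blast
qed

end

section \<open>Backward deterministic chains\<close>

lemma martingale_set_integral:
  assumes mart: "martingale M F Y" and "m \<le> n" and A: "A \<in> sets (F m)"
  shows "(LINT x:A|M. Y n x) = (LINT x:A|M. Y m x)"
proof -
  interpret prob_space M using mart by (simp add: martingale_def)
  have sub: "subalgebra M (F m)" using mart by (simp add: martingale_def)
  interpret S: finite_measure_subalgebra M "F m" by unfold_locales (rule sub)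
  have int: "integrable M (Y n)" "integrable M (Y m)" using mart by (auto simp: martingale_def)
  have ae: "AE x in M. real_cond_exp M (F m) (Y n) x = Y m x" using mart assms(2) by (simp add: martingale_def)
  have AM: "A \<in> sets M" using A sub by (auto simp: subalgebra_def)
  have "(LINT x:A|M. Y n x) = (LINT x:A|M. real_cond_exp M (F m) (Y n) x)"
    by (rule S.real_cond_exp_intA[OF int(1) A])
  also have "\<dots> = (LINT x:A|M. Y m x)"
  proof (rule set_lebesgue_integral_cong_AE[OF AM])
    show "AE x \<in> A in M. real_cond_exp M (F m) (Y n) x = Y m x" using ae by eventually_elim simp
  qed (use int in simp_all)
  finally show ?thesis .
qed

text \<open>Jensen's inequality for a put payoff: on the event \<open>Y n < k\<close>, known at time
  \<open>n\<close>, the payoff is affine, so \<open>Y n\<close> may be replaced by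
  \<open>Y (Suc n)\<close>; the positive part then dominates.\<close>

lemma martingale_potential_mono:
  assumes mart: "martingale M F Y"
  shows "(LINT x|M. max 0 (k - Y n x)) \<le> (LINT x|M. max 0 (k - Y (Suc n) x) :: real)"
proof -
  interpret prob_space M using mart by (simp add: martingale_def)
  have sub: "subalgebra M (F n)" using mart by (simp add: martingale_def)
  have int[simp]: "integrable M (Y n)" "integrable M (Y (Suc n))" using mart by (auto simp: martingale_def)
  have meas: "Y n \<in> borel_measurable (F n)" using mart by (simp add: martingale_def)
  define A where "A = {x \<in> space M. Y n x < k}"
  have spF: "space (F n) = space M" using sub by (simp add: subalgebra_def)
  have A: "A \<in> sets (F n)" unfolding A_def spF[symmetric] using meas by measurable
  then have AM: "A \<in> sets M" using sub by (auto simp: subalgebra_def)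
  have aff: "integrable M (\<lambda>x. k - Y (Suc n) x)" by simp
  have "(LINT x|M. max 0 (k - Y n x)) = (LINT x:A|M. k - Y n x)"
    unfolding set_lebesgue_integral_def
    by (rule Bochner_Integration.integral_cong) (auto simp: A_def indicator_def)
  also have "\<dots> = (LINT x:A|M. k - Y (Suc n) x)"
    using martingale_set_integral[OF mart _ A, of "Suc n"]
    by (simp add: set_integral_affine[OF int(1) AM] set_integral_affine[OF int(2) AM])
  also have "\<dots> \<le> (LINT x|M. max 0 (k - Y (Suc n) x))"
    unfolding set_lebesgue_integral_def
  proof (rule integral_mono)
    show "integrable M (\<lambda>x. indicat_real A x *\<^sub>R (k - Y (Suc n) x))"
      by (rule integrable_mult_indicator[OF AM aff])
    show "integrable M (\<lambda>x. max 0 (k - Y (Suc n) x))" using aff by simp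
    show "indicat_real A x *\<^sub>R (k - Y (Suc n) x) \<le> max 0 (k - Y (Suc n) x)" for x
      by (simp add: indicator_def)
  qed
  finally show ?thesis .
qed

text \<open>For \<open>j \<le> n\<close> this is the composition of the maps from \<open>f j\<close>
  to \<open>f (n - 1)\<close>, recovering the state at time \<open>j\<close> from that at time
  \<open>n\<close>. For \<open>j > n\<close> it is the identity, a mere default.\<close>

primrec pull :: "(nat \<Rightarrow> real \<Rightarrow> real) \<Rightarrow> nat \<Rightarrow> nat \<Rightarrow> real \<Rightarrow> real" where
  "pull f j 0 x = x"
| "pull f j (Suc n) x = (if j \<le> n then pull f j n (f n x) else x)"

lemma pull_self [simp]: "pull f n n x = x"
  by (cases n) auto

section \<open>Finite-dimensional laws of the chain\<close>

locale backward_chain =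
  fixes \<nu> :: "nat \<Rightarrow> real measure" and f :: "nat \<Rightarrow> real \<Rightarrow> real"
  assumes prob_nu: "\<And>n. prob_space (\<nu> n)"
    and sets_nu [simp, measurable_cong]: "\<And>n. sets (\<nu> n) = sets borel"
    and f_meas [measurable]: "\<And>n. f n \<in> borel_measurable borel"
    and f_distr: "\<And>n. distr (\<nu> (Suc n)) borel (f n) = \<nu> n"
    and nu_int: "\<And>n. integrable (\<nu> n) (\<lambda>x. x)"
    and f_bary: "\<And>n B. B \<in> sets borel \<Longrightarrow> (LINT y:f n -` B|\<nu> (Suc n). y) = (LINT x:B|\<nu> n. x)"
begin

lemma space_nu [simp]: "space (\<nu> n) = UNIV"
  using sets_eq_imp_space_eq[OF sets_nu[of n]] by simp

lemma pull_meas [measurable]: "pull f j n \<in> borel_measurable borel"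
proof (induction n)
  case 0
  have "pull f j 0 = (\<lambda>x. x)" by auto
  then show ?case by simp
next
  case (Suc n)
  have "pull f j (Suc n) = (\<lambda>x. if j \<le> n then pull f j n (f n x) else x)" by auto
  moreover have "(\<lambda>x. pull f j n (f n x)) \<in> borel_measurable borel"
    using measurable_compose[OF f_meas Suc] .
  ultimately show ?case by simp
qed

text \<open>The intended law of the coordinates in \<open>J\<close>, read backward from time
  \<open>n\<close>; meaningful for \<open>J \<subseteq> {..n}\<close>.\<close>

definition joint :: "nat \<Rightarrow> nat set \<Rightarrow> (nat \<Rightarrow> real) measure" where
  "joint n J = distr (\<nu> n) (\<Pi>\<^sub>M j\<in>J. borel) (\<lambda>x. \<lambda>j\<in>J. pull f j n x)"

lemma joint_meas [measurable]: "(\<lambda>x. \<lambda>j\<in>J. pull f j n x) \<in> borel \<rightarrow>\<^sub>M (\<Pi>\<^sub>M j\<in>J. borel)"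
  by (rule measurable_restrict) simp

lemma joint_meas_nu: "(\<lambda>x. \<lambda>j\<in>J. pull f j n x) \<in> \<nu> k \<rightarrow>\<^sub>M (\<Pi>\<^sub>M j\<in>J. borel)"
  by (subst measurable_cong_sets[OF sets_nu refl]) (rule joint_meas)

text \<open>Every coordinate up to time \<open>n\<close> factors through \<open>f n\<close>, which
  pushes the law at \<open>Suc n\<close> to the law at \<open>n\<close>.\<close>

lemma joint_Suc:
  assumes "J \<subseteq> {..n}" shows "joint (Suc n) J = joint n J"
proof -
  have "joint n J = distr (distr (\<nu> (Suc n)) borel (f n)) (\<Pi>\<^sub>M j\<in>J. borel) (\<lambda>x. \<lambda>j\<in>J. pull f j n x)"
    by (simp add: joint_def f_distr)
  also have "\<dots> = distr (\<nu> (Suc n)) (\<Pi>\<^sub>M j\<in>J. borel) ((\<lambda>x. \<lambda>j\<in>J. pull f j n x) \<circ> f n)"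
    by (rule distr_distr) measurable
  also have "(\<lambda>x. \<lambda>j\<in>J. pull f j n x) \<circ> f n = (\<lambda>x. \<lambda>j\<in>J. pull f j (Suc n) x)"
    using assms by (auto simp: fun_eq_iff restrict_def)
  finally show ?thesis unfolding joint_def[of "Suc n"] by (rule sym)
qed

lemma joint_eq:
  assumes "J \<subseteq> {..m}" "m \<le> n" shows "joint n J = joint m J"
  using assms(2)
proof (induction n rule: dec_induct)
  case (step n)
  then have "J \<subseteq> {..n}" using assms(1) by auto
  then show ?case using joint_Suc step by simp
qed simp

text \<open>Inserting 0 gives the maximum a meaning when \<open>J\<close> is empty; any later
  starting time yields the same law.\<close>

definition marginal :: "nat set \<Rightarrow> (nat \<Rightarrow> real) measure" where
  "marginal J = joint (Max (insert 0 J)) J"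

lemma marginal_eq:
  assumes "J \<subseteq> {..n}" shows "marginal J = joint n J"
proof -
  have "finite J" using assms finite_subset by blast
  then have "J \<subseteq> {..Max (insert 0 J)}" "Max (insert 0 J) \<le> n" using assms by auto
  then show ?thesis unfolding marginal_def by (metis joint_eq)
qed

text \<open>For a common starting time \<open>n\<close> beyond \<open>H\<close>, both laws are
  images of \<open>\<nu> n\<close>, and restricting coordinates is composition of the maps.\<close>

lemma projective: "polish_projective UNIV marginal"
proof -
  have "projective_family UNIV marginal (\<lambda>_. borel :: real measure)"
  proof (rule projective_family.intro)
    fix J H :: "nat set" assume JH: "J \<subseteq> H" "finite H"
    obtain n where n: "H \<subseteq> {..n}" using JH(2) by (meson finite_nat_iff_bounded_le)
    have "distr (marginal H) (\<Pi>\<^sub>M j\<in>J. borel) (\<lambda>h. restrict h J) = distr (\<nu> n) (\<Pi>\<^sub>M j\<in>J. borel) ((\<lambda>h. restrict h J) \<circ> (\<lambda>x. \<lambda>j\<in>H. pull f j n x))"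
      unfolding marginal_eq[OF n] joint_def using JH(1)
      by (intro distr_distr measurable_restrict_subset) measurable
    also have "(\<lambda>h. restrict h J) \<circ> (\<lambda>x. \<lambda>j\<in>H. pull f j n x) = (\<lambda>x. \<lambda>j\<in>J. pull f j n x)"
      using JH(1) by (auto simp: fun_eq_iff restrict_def)
    also have "distr (\<nu> n) (\<Pi>\<^sub>M j\<in>J. borel) (\<lambda>x. \<lambda>j\<in>J. pull f j n x) = marginal J"
      using marginal_eq[of J n] n JH(1) by (auto simp: joint_def)
    finally show "marginal J = distr (marginal H) (\<Pi>\<^sub>M j\<in>J. borel) (\<lambda>h. restrict h J)" by (rule sym)
  next
    fix J :: "nat set" assume "finite J"
    show "prob_space (marginal J)"
      unfolding marginal_def joint_def by (rule prob_space.prob_space_distr[OF prob_nu]) measurable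
  qed
  then show ?thesis by (simp add: polish_projective_def)
qed

section \<open>Kolmogorov extension\<close>

definition ambient :: "(nat \<Rightarrow> real) measure" where
  "ambient = projective_family.lim UNIV marginal (\<lambda>_. borel)"

lemma sets_ambient [measurable_cong]: "sets ambient = sets (\<Pi>\<^sub>M j\<in>UNIV. borel)"
proof -
  interpret L: polish_projective UNIV marginal by (rule projective)
  show ?thesis by (simp add: ambient_def)
qed

lemma prob_ambient: "prob_space ambient"
proof -
  interpret L: polish_projective UNIV marginal by (rule projective)
  show ?thesis unfolding ambient_def by (rule L.P.prob_space_axioms)
qed

lemma space_ambient [simp]: "space ambient = UNIV"
  using sets_eq_imp_space_eq[OF sets_ambient] by (simp add: space_PiM)

lemma coord_meas [measurable]: "(\<lambda>\<omega>. \<omega> n) \<in> borel_measurable ambient"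
  by (subst measurable_cong_sets[OF sets_ambient refl]) (rule measurable_component_singleton, simp)

lemma restrict_meas: "(\<lambda>\<omega>. restrict \<omega> J) \<in> ambient \<rightarrow>\<^sub>M (\<Pi>\<^sub>M j\<in>J. borel)"
  by (subst measurable_cong_sets[OF sets_ambient refl]) (rule measurable_restrict_subset, simp)

lemma distr_ambient:
  assumes "J \<subseteq> {..n}"
  shows "distr ambient (\<Pi>\<^sub>M j\<in>J. borel) (\<lambda>\<omega>. restrict \<omega> J) = joint n J"
proof (rule measure_eqI)
  show "sets (distr ambient (\<Pi>\<^sub>M j\<in>J. borel) (\<lambda>\<omega>. restrict \<omega> J)) = sets (joint n J)"
    by (simp add: joint_def)
  fix A assume "A \<in> sets (distr ambient (\<Pi>\<^sub>M j\<in>J. borel) (\<lambda>\<omega>. restrict \<omega> J))"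
  then have A: "A \<in> sets (\<Pi>\<^sub>M j\<in>J. borel)" by simp
  interpret L: polish_projective UNIV marginal by (rule projective)
  have fin: "finite J" using assms finite_subset by blast
  have "emeasure (distr ambient (\<Pi>\<^sub>M j\<in>J. borel) (\<lambda>\<omega>. restrict \<omega> J)) A =
      emeasure ambient ((\<lambda>\<omega>. restrict \<omega> J) -` A \<inter> space ambient)"
    using restrict_meas A by (rule emeasure_distr)
  also have "(\<lambda>\<omega>. restrict \<omega> J) -` A \<inter> space ambient = L.emb UNIV J A"
    by (auto simp: prod_emb_def)
  also have "emeasure ambient \<dots> = emeasure (marginal J) A"
    unfolding ambient_def using fin A by (intro L.emeasure_lim_emb) auto
  also have "\<dots> = emeasure (joint n J) A"
    using marginal_eq[OF assms] by (rule arg_cong)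
  finally show "emeasure (distr ambient (\<Pi>\<^sub>M j\<in>J. borel) (\<lambda>\<omega>. restrict \<omega> J)) A = emeasure (joint n J) A" .
qed

lemma distr_coord: "distr ambient borel (\<lambda>\<omega>. \<omega> n) = \<nu> n"
proof -
  have c: "(\<lambda>h. h n) \<in> borel_measurable (\<Pi>\<^sub>M j\<in>{n}. borel :: real measure)"
    by (rule measurable_component_singleton) simp
  have "distr ambient borel (\<lambda>\<omega>. \<omega> n) = distr ambient borel ((\<lambda>h. h n) \<circ> (\<lambda>\<omega>. restrict \<omega> {n}))"
    by (simp add: comp_def)
  also have "\<dots> = distr (joint n {n}) borel (\<lambda>h. h n)"
    using distr_ambient[of "{n}" n] distr_distr[OF c restrict_meas] by simp
  also have "\<dots> = distr (\<nu> n) borel (\<lambda>x. x)"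
    unfolding joint_def distr_distr[OF c joint_meas_nu] by (simp add: comp_def)
  also have "\<dots> = \<nu> n" by (rule distr_id2) simp
  finally show ?thesis .
qed

section \<open>Restriction to exact trajectories\<close>

definition paths :: "(nat \<Rightarrow> real) set" where
  "paths = {\<omega>. \<forall>j. \<omega> j = f j (\<omega> (Suc j))}"

lemma pathsD: "\<omega> \<in> paths \<Longrightarrow> \<omega> j = f j (\<omega> (Suc j))"
  unfolding paths_def by blast

lemma paths_sets [measurable]: "paths \<in> sets ambient"
proof -
  have "paths = {\<omega> \<in> space ambient. \<forall>j. \<omega> j = f j (\<omega> (Suc j))}" unfolding paths_def space_ambient by blast
  also have "\<dots> \<in> sets ambient"
    by (intro sets.sets_Collect_countable_All borel_measurable_eq coord_meas measurable_compose[OF coord_meas f_meas])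
  finally show ?thesis .
qed

text \<open>Each equation involves only the coordinates \<open>j\<close> and \<open>Suc j\<close>,
  whose joint law is carried by the graph of \<open>f j\<close>; there are countably many
  equations.\<close>

lemma AE_paths: "AE \<omega> in ambient. \<omega> \<in> paths"
proof -
  have "AE \<omega> in ambient. \<omega> j = f j (\<omega> (Suc j))" for j
  proof -
    let ?J = "{j, Suc j}"
    have J: "distr ambient (\<Pi>\<^sub>M j\<in>?J. borel) (\<lambda>\<omega>. restrict \<omega> ?J) = joint (Suc j) ?J"
      by (rule distr_ambient) auto
    have c: "(\<lambda>h. h j) \<in> borel_measurable (\<Pi>\<^sub>M j\<in>?J. borel :: real measure)"
      "(\<lambda>h. h (Suc j)) \<in> borel_measurable (\<Pi>\<^sub>M j\<in>?J. borel :: real measure)"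
      by (auto intro: measurable_component_singleton)
    have c': "(\<lambda>h. f j (h (Suc j))) \<in> borel_measurable (\<Pi>\<^sub>M j\<in>?J. borel :: real measure)"
      using measurable_compose[OF c(2) f_meas] .
    have m: "{h \<in> space (\<Pi>\<^sub>M j\<in>?J. borel :: real measure). h j = f j (h (Suc j))} \<in> sets (\<Pi>\<^sub>M j\<in>?J. borel)"
      using c(1) c' by measurable
    have "AE h in joint (Suc j) ?J. h j = f j (h (Suc j))"
      unfolding joint_def by (subst AE_distr_iff[OF joint_meas_nu m]) simp
    then have "AE h in distr ambient (\<Pi>\<^sub>M j\<in>?J. borel) (\<lambda>\<omega>. restrict \<omega> ?J). h j = f j (h (Suc j))"
      unfolding J .
    then show ?thesis by (subst (asm) AE_distr_iff[OF restrict_meas m]) simp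
  qed
  then show ?thesis unfolding paths_def mem_Collect_eq AE_all_countable by (rule allI)
qed

lemma paths_pull:
  assumes "\<omega> \<in> paths" "j \<le> n" shows "\<omega> j = pull f j n (\<omega> n)"
  using assms(2)
proof (induction n rule: dec_induct)
  case (step n)
  then show ?case using pathsD[OF assms(1), of n] by simp
qed simp

text \<open>Discarding the exceptional trajectories makes the recursion hold at every sample point,
  as measurability without exceptional null sets demands.\<close>

definition law :: "(nat \<Rightarrow> real) measure" where
  "law = restrict_space ambient paths"

lemma space_law: "space law = paths"
  by (simp add: law_def space_restrict_space space_ambient)

lemma prob_law: "prob_space law"
  unfolding law_def
proof (rule prob_space_restrict_space)
  show "emeasure ambient paths = 1"
    using AE_paths prob_space.prob_eq_1[OF prob_ambient paths_sets]
    by (simp add: finite_measure.emeasure_eq_measure[OF prob_space.finite_measure[OF prob_ambient]])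
qed simp

lemma law_coord_meas [measurable]: "(\<lambda>\<omega>. \<omega> n) \<in> borel_measurable law"
  unfolding law_def by (rule measurable_restrict_space1) measurable

lemma distr_law: "distr law borel (\<lambda>\<omega>. \<omega> n) = \<nu> n"
proof (rule measure_eqI)
  fix B assume "B \<in> sets (distr law borel (\<lambda>\<omega>. \<omega> n))"
  then have B[measurable]: "B \<in> sets borel" by simp
  have "emeasure (distr law borel (\<lambda>\<omega>. \<omega> n)) B = emeasure law ((\<lambda>\<omega>. \<omega> n) -` B \<inter> paths)"
    by (simp add: emeasure_distr space_law)
  also have "\<dots> = emeasure ambient ((\<lambda>\<omega>. \<omega> n) -` B \<inter> paths)"
    unfolding law_def by (rule emeasure_restrict_space) (auto simp: space_ambient)
  also have "\<dots> = emeasure ambient ((\<lambda>\<omega>. \<omega> n) -` B \<inter> space ambient)"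
  proof (rule emeasure_eq_AE)
    show "AE \<omega> in ambient. \<omega> \<in> (\<lambda>\<omega>. \<omega> n) -` B \<inter> paths \<longleftrightarrow> \<omega> \<in> (\<lambda>\<omega>. \<omega> n) -` B \<inter> space ambient"
      using AE_paths by eventually_elim (simp add: space_ambient)
    have "(\<lambda>\<omega>. \<omega> n) -` B \<inter> paths = ((\<lambda>\<omega>. \<omega> n) -` B \<inter> space ambient) \<inter> paths"
      by (auto simp: space_ambient)
    also have "\<dots> \<in> sets ambient" by (intro sets.Int measurable_sets[OF coord_meas] paths_sets B)
    finally show "(\<lambda>\<omega>. \<omega> n) -` B \<inter> paths \<in> sets ambient" .
  qed measurable
  also have "\<dots> = emeasure (distr ambient borel (\<lambda>\<omega>. \<omega> n)) B" by (simp add: emeasure_distr)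
  finally show "emeasure (distr law borel (\<lambda>\<omega>. \<omega> n)) B = emeasure (\<nu> n) B" by (simp add: distr_coord)
qed simp

lemma law_int: "integrable law (\<lambda>\<omega>. \<omega> n)"
proof -
  have "integrable (distr law borel (\<lambda>\<omega>. \<omega> n)) (\<lambda>x. x)" unfolding distr_law by (rule nu_int)
  then show ?thesis by (subst (asm) integrable_distr_eq) auto
qed

lemma law_set_integral:
  assumes B[measurable]: "B \<in> sets borel"
  shows "(LINT \<omega>:(\<lambda>\<omega>. \<omega> n) -` B \<inter> paths|law. \<omega> n) = (LINT x:B|\<nu> n. x)"
proof -
  have "(LINT x:B|\<nu> n. x) = (LINT x|distr law borel (\<lambda>\<omega>. \<omega> n). indicat_real B x *\<^sub>R x)"
    by (simp add: distr_law set_lebesgue_integral_def)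
  also have "\<dots> = (LINT \<omega>|law. indicat_real B (\<omega> n) *\<^sub>R \<omega> n)"
    by (rule integral_distr) measurable
  also have "\<dots> = (LINT \<omega>:(\<lambda>\<omega>. \<omega> n) -` B \<inter> paths|law. \<omega> n)"
    unfolding set_lebesgue_integral_def
    by (rule Bochner_Integration.integral_cong) (auto simp: space_law indicator_def)
  finally show ?thesis ..
qed

text \<open>On trajectories an event of coordinate \<open>m\<close> is an event of coordinate
  \<open>n\<close>, and equally one of coordinate \<open>Suc n\<close>. The barycentre identity of
  \<open>f n\<close> therefore allows one step forward in time, and induction does the rest.\<close>

lemma law_martingale_step:
  assumes "m \<le> n" "B \<in> sets borel"
  shows "(LINT \<omega>:(\<lambda>\<omega>. \<omega> m) -` B \<inter> paths|law. \<omega> n) = (LINT \<omega>:(\<lambda>\<omega>. \<omega> m) -` B \<inter> paths|law. \<omega> m)"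
  using assms(1)
proof (induction n rule: dec_induct)
  case (step n)
  define A where "A = pull f m n -` B"
  have A: "A \<in> sets borel" unfolding A_def using measurable_sets[OF pull_meas assms(2)] by simp
  have fA: "f n -` A \<in> sets borel" using measurable_sets[OF f_meas A] by simp
  have "(\<lambda>\<omega>. \<omega> m) -` B \<inter> paths = (\<lambda>\<omega>. \<omega> n) -` A \<inter> paths"
    using paths_pull[OF _ step.hyps(1)] by (auto simp: A_def)
  moreover have "(\<lambda>\<omega>. \<omega> n) -` A \<inter> paths = (\<lambda>\<omega>. \<omega> (Suc n)) -` (f n -` A) \<inter> paths"
  proof -
    have "\<omega> n \<in> A \<longleftrightarrow> f n (\<omega> (Suc n)) \<in> A" if "\<omega> \<in> paths" for \<omega>
      by (simp only: pathsD[OF that, of n])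
    then show ?thesis by blast
  qed
  ultimately show ?case
    using step.IH law_set_integral[OF A, of n] law_set_integral[OF fA, of "Suc n"] f_bary[OF A, of n] by simp
qed simp

section \<open>Natural filtration, martingale property and backward determinism\<close>

abbreviation "coord \<equiv> (\<lambda>n \<omega>. \<omega> n :: real)"

lemma natural_filtration_gen:
  "{coord j -` B \<inter> space law | j B. j \<le> n \<and> B \<in> sets borel} \<subseteq> Pow (space law)"
  by auto

text \<open>Earlier coordinates are Borel functions of the present one on trajectories, so the past
  generates nothing beyond the present. Conditional expectations then need testing only on events of
  a single coordinate.\<close>

lemma sets_natural_filtration:
  "sets (natural_filtration law coord n) = {coord n -` B \<inter> paths | B. B \<in> sets borel}"
proof -
  have "sets (natural_filtration law coord n) =
      sigma_sets paths {coord j -` B \<inter> paths | j B. j \<le> n \<and> B \<in> sets borel}"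
    unfolding natural_filtration_def using natural_filtration_gen by (simp add: sets_measure_of space_law)
  also have "\<dots> = sets (vimage_algebra paths (coord n) borel)"
  proof
    show "sigma_sets paths {coord j -` B \<inter> paths | j B. j \<le> n \<and> B \<in> sets borel} \<subseteq> sets (vimage_algebra paths (coord n) borel)"
    proof -
      have "coord j -` B \<inter> paths \<in> sets (vimage_algebra paths (coord n) borel)" if "j \<le> n" "B \<in> sets borel" for j B
      proof -
        have "coord j -` B \<inter> paths = coord n -` (pull f j n -` B) \<inter> paths"
          using paths_pull[OF _ that(1)] by auto
        moreover have "pull f j n -` B \<in> sets borel" using measurable_sets[OF pull_meas that(2)] by simp
        ultimately show ?thesis by (auto intro: in_vimage_algebra)
      qed
      then have "{coord j -` B \<inter> paths | j B. j \<le> n \<and> B \<in> sets borel} \<subseteq> sets (vimage_algebra paths (coord n) borel)"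
        by auto
      from sets.sigma_sets_subset[OF this] show ?thesis by simp
    qed
    show "sets (vimage_algebra paths (coord n) borel) \<subseteq> sigma_sets paths {coord j -` B \<inter> paths | j B. j \<le> n \<and> B \<in> sets borel}"
      by (auto simp: sets_vimage_algebra2 intro!: sigma_sets.Basic)
  qed
  also have "\<dots> = {coord n -` B \<inter> paths | B. B \<in> sets borel}"
    by (simp add: sets_vimage_algebra2)
  finally show ?thesis .
qed

lemma space_natural_filtration: "space (natural_filtration law coord n) = paths"
  unfolding natural_filtration_def using natural_filtration_gen by (simp add: space_measure_of space_law)

lemma law_martingale: "martingale law (natural_filtration law coord) coord"
proof -
  interpret prob_space law by (rule prob_law)
  let ?F = "natural_filtration law coord"
  have mono: "sets (?F i) \<subseteq> sets (?F j)" if "i \<le> j" for i j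
    unfolding natural_filtration_def sets_measure_of[OF natural_filtration_gen]
    using that by (intro sigma_sets_mono') force
  have sub: "subalgebra law (?F n)" for n
  proof -
    have "coord n -` B \<inter> paths \<in> sets law" if "B \<in> sets borel" for B
      using measurable_sets[OF law_coord_meas that] by (simp add: space_law)
    then show ?thesis
      by (auto simp: subalgebra_def space_natural_filtration space_law sets_natural_filtration)
  qed
  have meas: "coord n \<in> borel_measurable (?F n)" for n
    by (rule measurableI) (auto simp: space_natural_filtration sets_natural_filtration)
  have "AE \<omega> in law. real_cond_exp law (?F m) (coord n) \<omega> = coord m \<omega>" if "m \<le> n" for m n
  proof -
    interpret S: finite_measure_subalgebra law "?F m" by unfold_locales (rule sub)
    show ?thesis
    proof (rule S.real_cond_exp_charact)
      fix A assume "A \<in> sets (?F m)"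
      then obtain B where "B \<in> sets borel" "A = coord m -` B \<inter> paths"
        by (auto simp: sets_natural_filtration)
      then show "(LINT \<omega>:A|law. coord n \<omega>) = (LINT \<omega>:A|law. coord m \<omega>)"
        using law_martingale_step[OF that] by simp
    qed (use law_int meas in auto)
  qed
  then show ?thesis
    unfolding martingale_def
    using prob_law sub meas law_int mono by (simp add: filtration_def space_natural_filtration space_law)
qed

lemma law_backward_deterministic: "backward_deterministic law coord"
  unfolding backward_deterministic_def space_law
proof
  fix n
  have "coord n \<in> vimage_algebra paths (coord n) borel \<rightarrow>\<^sub>M borel"
    by (rule measurable_vimage_algebra1) simp
  then have "(\<lambda>\<omega>. \<lambda>j\<in>{..n}. pull f j n (\<omega> n)) \<in> vimage_algebra paths (coord n) borel \<rightarrow>\<^sub>M (\<Pi>\<^sub>M j\<in>{..n}. borel)"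
    using measurable_compose[OF _ joint_meas] by blast
  moreover have "(\<lambda>j\<in>{..n}. \<omega> j) = (\<lambda>j\<in>{..n}. pull f j n (\<omega> n))" if "\<omega> \<in> paths" for \<omega>
    using paths_pull[OF that] by (auto simp: fun_eq_iff restrict_def)
  ultimately show "(\<lambda>\<omega>. \<lambda>j\<in>{..n}. \<omega> j) \<in> vimage_algebra paths (coord n) borel \<rightarrow>\<^sub>M (\<Pi>\<^sub>M j\<in>{..n}. borel)"
    by (subst measurable_cong[where g = "\<lambda>\<omega>. \<lambda>j\<in>{..n}. pull f j n (\<omega> n)"]) (auto simp: space_vimage_algebra)
qed

end

section \<open>Application to a given martingale\<close>

lemma atomless_singleton:
  fixes \<mu> :: "real measure"
  assumes "atomless \<mu>" "sets \<mu> = sets borel"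
  shows "measure \<mu> {c} = 0"
proof (rule ccontr)
  assume "measure \<mu> {c} \<noteq> 0"
  then have "emeasure \<mu> {c} > 0" by (auto simp: measure_def zero_less_iff_neq_zero)
  moreover have "{c} \<in> sets \<mu>" using assms(2) by simp
  ultimately obtain B where "B \<subseteq> {c}" "0 < emeasure \<mu> B" "emeasure \<mu> B < emeasure \<mu> {c}"
    using assms(1) unfolding atomless_def by blast
  then show False by (auto simp: subset_singleton_iff)
qed

text \<open>The second member of the pair is the identity under the law of \<open>Y (Suc n)\<close>
  rather than \<open>Y (Suc n)\<close> itself, so that the resulting map is a Borel function of the
  value alone.\<close>

lemma martingale_backward_map:
  fixes Y :: "nat \<Rightarrow> 'a \<Rightarrow> real"
  assumes mart: "martingale M F Y" and "atomless (distr M borel (Y (Suc n)))"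
  shows "\<exists>f \<in> borel_measurable borel. distr (distr M borel (Y (Suc n))) borel f = distr M borel (Y n) \<and>
    (\<forall>B\<in>sets borel. (LINT y:f -` B|distr M borel (Y (Suc n)). y) = (LINT x:B|distr M borel (Y n). x))"
proof -
  interpret prob_space M using mart by (simp add: martingale_def)
  have int[simp]: "integrable M (Y i)" for i using mart by (simp add: martingale_def)
  have meas[measurable]: "Y i \<in> borel_measurable M" for i using int by (rule borel_measurable_integrable)
  define \<nu> where "\<nu> i = distr M borel (Y i)" for i
  have [simp]: "sets (\<nu> i) = sets borel" "space (\<nu> i) = UNIV" for i by (auto simp: \<nu>_def)
  have prob: "prob_space (\<nu> i)" for i unfolding \<nu>_def by (rule prob_space_distr) measurable
  interpret N: prob_space "\<nu> (Suc n)" by (rule prob)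
  have nint: "integrable (\<nu> i) (\<lambda>x. x)" for i
    unfolding \<nu>_def by (subst integrable_distr_eq) auto
  interpret atomless_prob_pair M "\<nu> (Suc n)" "Y n" "\<lambda>x. x"
  proof unfold_locales
    show "measure (\<nu> (Suc n)) {y \<in> space (\<nu> (Suc n)). y = c} = 0" for c
      using atomless_singleton[of "\<nu> (Suc n)" c] assms(2) by (simp add: \<nu>_def)
  qed (use nint in auto)
  have "cx_dom M (Y n) (space M) (\<nu> (Suc n)) (\<lambda>x. x) (space (\<nu> (Suc n)))"
  proof -
    have "(LINT x:space M|M. Y n x) = (LINT x:space M|M. Y (Suc n) x)"
      using martingale_set_integral[OF mart, of n "Suc n" "space M"] mart
      by (metis le_SucI order_refl sets.top martingale_def subalgebra_def)
    then have mean: "(LINT x|M. Y n x) = (LINT x|\<nu> (Suc n). x)"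
      by (simp add: set_integral_space \<nu>_def integral_distr)
    have "(LINT x|M. max 0 (k - Y n x)) \<le> (LINT x|\<nu> (Suc n). max 0 (k - x))" for k
    proof -
      have "(LINT x|\<nu> (Suc n). max 0 (k - x)) = (LINT x|M. max 0 (k - Y (Suc n) x))"
        unfolding \<nu>_def by (rule integral_distr) measurable
      then show ?thesis using martingale_potential_mono[OF mart, of k n] by simp
    qed
    moreover have "(LINT x:UNIV|\<nu> (Suc n). g x) = (LINT x|\<nu> (Suc n). g x)" for g :: "real \<Rightarrow> real"
      by (simp add: set_lebesgue_integral_def)
    ultimately show ?thesis
      using mean N.prob_space prob_space by (simp add: cx_dom_def set_integral_space)
  qed
  then obtain f where f: "f \<in> borel_measurable (\<nu> (Suc n))" "distr (\<nu> (Suc n)) borel f = \<nu> n"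
    and bary: "\<And>B. B \<in> sets borel \<Longrightarrow>
      (LINT y:f -` B \<inter> space (\<nu> (Suc n))|\<nu> (Suc n). y) = (LINT x:Y n -` B \<inter> space M|M. Y n x)"
    using backward_map_exists unfolding \<nu>_def by metis
  have fb: "f \<in> borel_measurable borel" using f(1) by (simp add: \<nu>_def)
  have "(LINT y:f -` B|\<nu> (Suc n). y) = (LINT x:B|\<nu> n. x)" if B[measurable]: "B \<in> sets borel" for B
  proof -
    have "(LINT x:B|\<nu> n. x) = (LINT x|M. indicat_real B (Y n x) *\<^sub>R Y n x)"
      unfolding \<nu>_def set_lebesgue_integral_def by (rule integral_distr) measurable
    also have "\<dots> = (LINT x:Y n -` B \<inter> space M|M. Y n x)"
      unfolding set_lebesgue_integral_def
      by (rule Bochner_Integration.integral_cong) (auto simp: indicator_def)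
    finally show ?thesis using bary[OF B] by simp
  qed
  then show ?thesis using fb f(2) unfolding \<nu>_def by blast
qed

theorem corollary3p6:
  fixes M :: "'a measure" and Y :: "nat \<Rightarrow> 'a \<Rightarrow> real"
  assumes "martingale M (natural_filtration M Y) Y"
    and "\<And>n. atomless (distr M borel (Y n))"
  shows "\<exists>(N :: (nat \<Rightarrow> real) measure) (X :: nat \<Rightarrow> (nat \<Rightarrow> real) \<Rightarrow> real).
           martingale N (natural_filtration N X) X \<and>
           backward_deterministic N X \<and>
           (\<forall>n. distr N borel (X n) = distr M borel (Y n))"
proof -
  interpret prob_space M using assms(1) by (simp add: martingale_def)
  have int: "integrable M (Y i)" for i using assms(1) by (simp add: martingale_def)
  have meas: "Y i \<in> borel_measurable M" for i using int by (rule borel_measurable_integrable)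
  obtain f where f: "\<And>n. f n \<in> borel_measurable borel"
      "\<And>n. distr (distr M borel (Y (Suc n))) borel (f n) = distr M borel (Y n)"
      "\<And>n B. B \<in> sets borel \<Longrightarrow>
        (LINT y:f n -` B|distr M borel (Y (Suc n)). y) = (LINT x:B|distr M borel (Y n). x)"
    using martingale_backward_map[OF assms(1) assms(2)] by metis
  interpret C: backward_chain "\<lambda>n. distr M borel (Y n)" f
  proof (rule backward_chain.intro)
    show "prob_space (distr M borel (Y n))" for n using meas by (rule prob_space_distr)
    show "integrable (distr M borel (Y n)) (\<lambda>x. x)" for n
      by (subst integrable_distr_eq) (auto simp: meas int)
  qed (use f in auto)
  show ?thesis
    using C.law_martingale C.law_backward_deterministic C.distr_law by (intro exI conjI allI)
qed

end
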